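(* Let $A$ be a positive integer and $\rho$ a real number. Suppose that $$\rho>A \ \text{ if } A\leq 3,\qquad \rho>\sigma_A^{-1}\ \text{ if } A\geq 4.$$ Then, for any $g(X)\in\mathcal{F}$ and any Pisot or Salem number $\beta$, the set $$\{\gamma(\rho;\beta^{-1})^{k_1}g(\beta^{-1})^{k_2}\mid k_1,k_2\in\mathbb{N},\ k_1\leq A\}$$ is linearly independent over $\mathbb{Q}(\beta)$.
   Context: $\mathbb{N}$ is the set of nonnegative integers; $\lfloor x\rfloor$ is the integral part of $x$. A Pisot number is an algebraic integer greater than $1$ whose conjugates other than itself all have absolute value less than $1$. A Salem number is an algebraic integer greater than $1$ whose conjugates other than itself all have absolute value at most $1$, with at least one conjugate of absolute value exactly $1$. For real $\rho>1$, $\gamma(\rho;X):=\sum_{m=0}^{\infty}X^{\lfloor m^{\rho}\rfloor}$. For an integer $k\geq 3$, $\sigma_k$ denotes the unique zero on the interval $(0,1)$ of $G_k(X):=(1-X)^k+(k-1)X-1$. For a formal power series $f(X)=\sum_{n\ge0}t_nX^n$ put $S(f):=\{n\in\mathbb{N}\mid t_n\neq0\}$; for a nonempty set $\mathcal{A}\subset\mathbb{N}$ put $\lambda(\mathcal{A};R):=\mathrm{Card}(\mathcal{A}\cap[0,R))$. $\mathcal{F}$ is the set of nonpolynomial power series $g(X)$ such that: (1) the coefficients of $g(X)$ are bounded nonnegative integers; (2) for an arbitrary positive real number $\varepsilon$, $\lambda(S(g);R)=o(R^{\varepsilon})$ as $R\to\infty$; (3) there exists a positive constant $C$ such that $[R,CR]\cap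 S(g)\neq\emptyset$ for any sufficiently large $R$. *)

theory Defs
  imports "HOL-Analysis.Analysis" "HOL-Library.Landau_Symbols"
    "HOL-Computational_Algebra.Computational_Algebra"
begin

definition is_minpoly :: "rat poly \<Rightarrow> complex \<Rightarrow> bool" where
  "is_minpoly p x \<longleftrightarrow> lead_coeff p = 1 \<and> irreducible p \<and> poly (map_poly of_rat p) x = 0"

text \<open>The conjugates over the rationals, the number itself included.\<close>

definition conjugates :: "complex \<Rightarrow> complex set" where
  "conjugates x = {z. \<exists>p. is_minpoly p x \<and> poly (map_poly of_rat p) z = 0}"

definition Pisot :: "real \<Rightarrow> bool" where
  "Pisot \<beta> \<longleftrightarrow> algebraic_int \<beta> \<and> \<beta> > 1 \<and>
     (\<forall>z \<in> conjugates (of_real \<beta>) - {of_real \<beta>}. norm z < 1)"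

definition Salem :: "real \<Rightarrow> bool" where
  "Salem \<beta> \<longleftrightarrow> algebraic_int \<beta> \<and> \<beta> > 1 \<and>
     (\<forall>z \<in> conjugates (of_real \<beta>) - {of_real \<beta>}. norm z \<le> 1) \<and>
     (\<exists>z \<in> conjugates (of_real \<beta>). norm z = 1)"

definition is_subfield :: "'a::field set \<Rightarrow> bool" where
  "is_subfield K \<longleftrightarrow> 1 \<in> K \<and> (\<forall>x\<in>K. \<forall>y\<in>K. x - y \<in> K \<and> x * y \<in> K) \<and> (\<forall>x\<in>K. inverse x \<in> K)"

text \<open>The field \<open>\<rat>(\<beta>)\<close>: a subfield of the reals contains \<open>\<rat>\<close> automatically.\<close>

definition rat_adjoin :: "real \<Rightarrow> real set" where
  "rat_adjoin \<beta> = is_subfield hull {\<beta>}"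

text \<open>Independence of an indexed family; in particular its members are pairwise distinct.
  (The library's notion of independence needs the scalars to form a type.)\<close>

definition lin_indep_family :: "'a::field set \<Rightarrow> 'i set \<Rightarrow> ('i \<Rightarrow> 'a) \<Rightarrow> bool" where
  "lin_indep_family K I f \<longleftrightarrow>
     (\<forall>J c. finite J \<longrightarrow> J \<subseteq> I \<longrightarrow> (\<forall>i\<in>J. c i \<in> K) \<longrightarrow> (\<Sum>i\<in>J. c i * f i) = 0 \<longrightarrow> (\<forall>i\<in>J. c i = 0))"

text \<open>For \<open>\<rho> > 0\<close> the term with \<open>m = 0\<close> is \<open>X ^ 0 = 1\<close>, since \<open>0 powr \<rho> = 0\<close>.\<close>

definition gamma_val :: "real \<Rightarrow> real \<Rightarrow> real" where
  "gamma_val \<rho> X = (\<Sum>m. X ^ nat \<lfloor>real m powr \<rho>\<rfloor>)"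

definition G_poly :: "nat \<Rightarrow> real \<Rightarrow> real" where
  "G_poly k X = (1 - X) ^ k + (real k - 1) * X - 1"

text \<open>Meaningful for \<open>k \<ge> 3\<close> only.\<close>

definition sigma_zero :: "nat \<Rightarrow> real" where
  "sigma_zero k = (THE X. 0 < X \<and> X < 1 \<and> G_poly k X = 0)"

definition supp :: "'a::zero fps \<Rightarrow> nat set" where
  "supp f = {n. fps_nth f n \<noteq> 0}"

definition count_below :: "nat set \<Rightarrow> real \<Rightarrow> nat" where
  "count_below \<A> R = card {n \<in> \<A>. real n < R}"

definition class_F :: "real fps set" where
  "class_F = {g.
     (\<nexists>p. g = fps_of_poly p) \<and>
     (\<forall>n. fps_nth g n \<in> \<nat>) \<and> (\<exists>B. \<forall>n. fps_nth g n \<le> B) \<and>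
     (\<forall>\<epsilon>>0. (\<lambda>R. real (count_below (supp g) R)) \<in> o[at_top](\<lambda>R. R powr \<epsilon>)) \<and>
     (\<exists>C>0. \<forall>\<^sub>F R in at_top. \<exists>n \<in> supp g. R \<le> real n \<and> real n \<le> C * R)}"

end

(* Suppose a nontrivial relation holds, with coefficients cleared to Z[beta]. Expanding in powers of
   1/beta gives sum_n a(n) beta^(-n) = 0 with a(n) in Z[beta]. The scaled tail
   Y(u) = sum_{n>u} a(n) beta^(u-n) equals minus the head sum_{n<=u} a(n) beta^(u-n), so it lies in
   Z[beta]; as all other conjugates of beta lie in the closed unit disc, those of Y(u) are bounded
   polynomially in u, and the norm gives Y(u) = 0 or |Y(u)| >= u^(-const). Hence every u < N with
   Y(u) <> 0 is followed within N^eps by some n with a(n) <> 0, and such u are sparse: at most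
   N^(h/rho + 2 eps) of them, where gamma^h g^b is the lexicographically largest monomial.
   On the other hand, let T be the union of the supports of the smaller monomials. In a gap (p,q)
   of T only gamma^h g^b contributes, all a(n) there have the same sign, and Y(u) <> 0 whenever
   p <= u < t for some support point t of gamma^h g^b not too close to q. If p comes from a monomial
   gamma^h g^j with j < b, adding a suitable element of the support of g produces such a t. The
   remaining p number at most N^((h-1)/rho + eps), and greedy approximation by h elements
   floor(m^rho) puts a t within O(N^((1-1/rho)^h)) of q. Since h/rho < 1 and
   (1-1/rho)^h + (h-1)/rho < 1, which is what the hypothesis on rho provides, a positive proportion
   of all u < N have Y(u) <> 0, a contradiction. *)

theory Submission
  imports Defs "Jordan_Normal_Form.Char_Poly" "HOL-Computational_Algebra.Field_as_Ring" "HOL-Real_Asymp.Real_Asymp"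
begin

hide_const (open) module.smult

section \<open>Minimal polynomials of algebraic integers and Gauss' lemma\<close>

lemma ex_int_multiple_rat_poly:
  fixes P :: "rat poly"
  obtains a :: int and P' :: "int poly" where "a > 0" "map_poly of_int P' = smult (of_int a) P"
proof -
  have "\<exists>a::int. \<exists>P'. a > 0 \<and> map_poly of_int P' = smult (of_int a) P"
  proof (induction P)
    case 0
    then show ?case by (intro exI[of _ 1] exI[of _ 0]) auto
  next
    case (pCons r P)
    then obtain a P' where aP: "a > 0" "map_poly of_int P' = smult (of_int a) P" by blast
    obtain c d where cd: "quotient_of r = (c, d)" by (cases "quotient_of r")
    have d: "d > 0" and r: "r = of_int c / of_int d"
      using cd quotient_of_denom_pos quotient_of_div by blast+
    have "map_poly of_int (pCons (a * c) (smult d P')) = smult (rat_of_int (a * d)) (pCons r P)"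
    proof -
      have "map_poly of_int (smult d P') = smult (rat_of_int d) (map_poly of_int P')"
        by (simp add: poly_eq_iff coeff_map_poly)
      moreover have "map_poly of_int (pCons (a * c) (smult d P')) =
          pCons (rat_of_int (a * c)) (map_poly rat_of_int (smult d P'))"
        by (simp add: poly_eq_iff coeff_map_poly coeff_pCons split: nat.split)
      ultimately show ?thesis using aP d r by (simp add: mult.commute)
    qed
    with aP(1) d show ?case by (intro exI[of _ "a*d"]) auto
  qed
  thus ?thesis using that by blast
qed

text \<open>Gauss' lemma: comparing contents, the common denominators of two monic rational factors
  must equal the contents of the scaled factors.\<close>

lemma monic_rat_factor_integral:
  fixes m :: "int poly" and P Q :: "rat poly"
  assumes m: "lead_coeff m = 1" and PQ: "map_poly of_int m = P * Q" and P: "lead_coeff P = 1"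
  obtains p :: "int poly" where "map_poly of_int p = P" "lead_coeff p = 1"
proof -
  have lm: "lead_coeff (map_poly of_int m :: rat poly) = 1"
    using m by (simp add: coeff_map_poly degree_map_poly)
  hence Q: "lead_coeff Q = 1" using PQ P by (simp add: lead_coeff_mult)
  obtain a P' where a: "a > 0" "map_poly of_int P' = smult (rat_of_int a) P"
    by (rule ex_int_multiple_rat_poly)
  obtain b Q' where b: "b > 0" "map_poly of_int Q' = smult (rat_of_int b) Q"
    by (rule ex_int_multiple_rat_poly)
  have lP: "lead_coeff P' = a"
  proof -
    have "lead_coeff (map_poly rat_of_int P') = rat_of_int a" using a P by simp
    thus ?thesis by (simp add: coeff_map_poly degree_map_poly)
  qed
  have lQ: "lead_coeff Q' = b"
  proof -
    have "lead_coeff (map_poly rat_of_int Q') = rat_of_int b" using b Q by simp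
    thus ?thesis by (simp add: coeff_map_poly degree_map_poly)
  qed
  have "map_poly rat_of_int (P' * Q') = map_poly rat_of_int P' * map_poly rat_of_int Q'"
    by (simp add: poly_eq_iff coeff_map_poly coeff_mult)
  also have "\<dots> = smult (of_int (a*b)) (P * Q)" using a b by (simp add: mult_ac)
  also have "\<dots> = map_poly rat_of_int (smult (a*b) m)"
    using PQ[symmetric] by (simp add: poly_eq_iff coeff_map_poly)
  finally have "P' * Q' = smult (a*b) m"
    by (simp add: poly_eq_iff coeff_map_poly del: of_int_mult coeff_smult)
  moreover have cm: "content m = 1"
  proof -
    have "content m dvd lead_coeff m" by (rule content_dvd_coeff)
    hence "content m dvd 1" using m by simp
    thus ?thesis by (metis is_unit_content_iff)
  qed
  ultimately have cc: "content P' * content Q' = a * b"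
    using a b content_mult[of P' Q'] by (simp add: abs_mult)
  have "content P' dvd a" "content Q' dvd b" using lP lQ content_dvd_coeff by metis+
  have content_nonneg: "content f \<ge> 0" for f :: "int poly"
    using normalize_content[of f] by (metis abs_ge_zero normalize_int_def)
  have "content P' \<noteq> 0" "content Q' \<noteq> 0" using cc a b by auto
  hence "content P' > 0" "content Q' > 0"
    using content_nonneg[of P'] content_nonneg[of Q'] by linarith+
  have le: "content P' \<le> a" "content Q' \<le> b"
    using \<open>content P' dvd a\<close> \<open>content Q' dvd b\<close> a b by (auto intro: zdvd_imp_le)
  have "content P' = a"
  proof (rule ccontr)
    assume "content P' \<noteq> a"
    hence "content P' * content Q' < a * b"
      using le a b \<open>content Q' > 0\<close> by (intro mult_less_le_imp_less) (auto simp: content_nonneg)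
    thus False using cc by simp
  qed
  define p where "p = primitive_part P'"
  have "P' = smult a p" unfolding p_def using \<open>content P' = a\<close> by (metis content_times_primitive_part)
  hence "smult (of_int a) (map_poly rat_of_int p) = smult (of_int a) P"
    using a(2) by (simp add: poly_eq_iff coeff_map_poly)
  hence e: "map_poly rat_of_int p = P" using a by (simp add: poly_eq_iff)
  moreover have "lead_coeff p = 1"
    using P unfolding e[symmetric] by (simp add: coeff_map_poly degree_map_poly)
  ultimately show ?thesis using that by blast
qed

interpretation of_rat_poly_hom: map_poly_idom_hom of_rat ..

text \<open>A Bezout identity \<open>u * P + v * Q = 1\<close>, evaluated at a common root, would
  give 0 = 1. It serves three times: for divisibility by the minimal polynomial, for separability,
  and for the nonvanishing of conjugates.\<close>

lemma irreducible_no_common_root: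
  fixes P Q :: "rat poly" and z :: "'a :: field_char_0"
  assumes "irreducible P" "\<not> P dvd Q" "poly (map_poly of_rat P) z = 0"
  shows "poly (map_poly of_rat Q) z \<noteq> 0"
proof
  assume Q: "poly (map_poly of_rat Q) z = 0"
  have "coprime P Q" using assms(1,2)
    by (intro prime_elem_imp_coprime field_poly_irreducible_imp_prime)
  then obtain u v where "u * P + v * Q = 1"
    by (metis bezout_coefficients_fst_snd coprime_imp_gcd_eq_1)
  hence "map_poly of_rat (u * P + v * Q) = (1 :: 'a poly)" by simp
  hence "poly (map_poly of_rat u * map_poly of_rat P + map_poly of_rat v * map_poly of_rat Q) z = (1::'a)"
    by (simp add: of_rat_poly_hom.hom_mult of_rat_poly_hom.hom_add)
  thus False using Q assms(3) by simp
qed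

lemma map_poly_of_rat_of_int:
  "map_poly of_rat (map_poly of_int p) = (map_poly of_int p :: 'a :: field_char_0 poly)"
  by (simp add: poly_eq_iff coeff_map_poly)

text \<open>A nonzero rational polynomial of least degree among those vanishing at \<beta> is
  irreducible, since a proper factorisation would yield one of smaller degree. Made monic, it
  divides the monic integer polynomial \<open>m\<close>, so Gauss' lemma makes it integral.\<close>

lemma algebraic_int_minpoly:
  fixes \<beta> :: real
  assumes "algebraic_int \<beta>"
  obtains p :: "int poly" where "lead_coeff p = 1" "is_minpoly (map_poly of_int p) (of_real \<beta>)"
proof -
  let ?ev = "\<lambda>P::rat poly. poly (map_poly of_rat P) (complex_of_real \<beta>)"
  have ev_mult: "?ev (P * Q) = ?ev P * ?ev Q" for P Q
    by (simp add: of_rat_poly_hom.hom_mult)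
  have ev_add: "?ev (P + Q) = ?ev P + ?ev Q" for P Q
    by (simp add: of_rat_poly_hom.hom_add)
  obtain m :: "int poly" where m: "poly (map_poly of_int m) \<beta> = 0" "lead_coeff m = 1"
    using assms by (auto simp: algebraic_int_altdef_ipoly)
  have "poly (map_poly of_int m) (complex_of_real \<beta>) = complex_of_real (poly (map_poly of_int m) \<beta>)"
    by (simp add: poly_altdef degree_map_poly coeff_map_poly)
  hence m0: "?ev (map_poly of_int m) = 0"
    using m by (simp add: map_poly_of_rat_of_int)
  define S where "S = (\<lambda>P::rat poly. P \<noteq> 0 \<and> ?ev P = 0)"
  have "S (map_poly of_int m)" using m0 m(2) by (auto simp: S_def)
  then obtain P0 where P0: "S P0" "\<And>Q. S Q \<Longrightarrow> degree P0 \<le> degree Q"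
    using ex_has_least_nat[of S "map_poly of_int m" degree] by blast
  define P where "P = smult (inverse (lead_coeff P0)) P0"
  have lP: "lead_coeff P = 1" and dP: "degree P = degree P0" and "P \<noteq> 0"
    using P0(1) by (auto simp: P_def S_def)
  have eP: "?ev P = 0"
  proof -
    have "?ev P = ?ev ([:inverse (lead_coeff P0):] * P0)" by (simp add: P_def)
    thus ?thesis using P0(1) unfolding ev_mult by (simp add: S_def)
  qed
  have min: "degree P \<le> degree Q" if "Q \<noteq> 0" "?ev Q = 0" for Q
    using P0(2)[of Q] that dP by (auto simp: S_def)
  have "degree P \<noteq> 0"
  proof
    assume "degree P = 0"
    then obtain c where "P = [:c:]" by (meson degree_eq_zeroE)
    with eP lP show False by simp
  qed
  have irr: "irreducible P"
  proof (rule irreducibleI)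
    show "P \<noteq> 0" by fact
    show "\<not> is_unit P" using \<open>degree P \<noteq> 0\<close> by (simp add: is_unit_iff_degree \<open>P \<noteq> 0\<close>)
  next
    fix a b assume ab: "P = a * b"
    hence nz: "a \<noteq> 0" "b \<noteq> 0" using \<open>P \<noteq> 0\<close> by auto
    hence "degree P = degree a + degree b" using ab by (simp add: degree_mult_eq)
    moreover have "?ev a = 0 \<or> ?ev b = 0" using eP ab ev_mult by auto
    ultimately have "degree a = 0 \<or> degree b = 0" using min[of a] min[of b] nz by auto
    thus "is_unit a \<or> is_unit b" using nz by (simp add: is_unit_iff_degree)
  qed
  have "P dvd map_poly of_int m"
  proof (rule ccontr)
    assume "\<not> P dvd map_poly of_int m"
    from irreducible_no_common_root[OF irr this eP] m0 show False by simp
  qed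
  then obtain Q where "map_poly of_int m = P * Q" by blast
  from monic_rat_factor_integral[OF m(2) this lP] obtain p :: "int poly"
    where "map_poly of_int p = P" "lead_coeff p = 1" by blast
  thus ?thesis using that[of p] irr eP lP by (simp add: is_minpoly_def)
qed

section \<open>Norms of elements of Z[\<beta>]\<close>

text \<open>In characteristic 0 the derivative is nonzero of smaller degree, so an irreducible
  polynomial shares no root with it and all complex roots are simple.\<close>

lemma card_roots_irreducible:
  fixes P :: "rat poly"
  assumes "irreducible P"
  shows "card {z::complex. poly (map_poly of_rat P) z = 0} = degree P"
proof -
  let ?P = "map_poly of_rat P :: complex poly"
  have "P \<noteq> 0" using assms by auto
  have dP: "degree P \<noteq> 0" using assms \<open>P \<noteq> 0\<close>
    by (metis irreducible_def is_unit_iff_degree)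
  have "\<not> P dvd pderiv P"
  proof
    assume "P dvd pderiv P"
    moreover have "pderiv P \<noteq> 0" using dP by (simp add: pderiv_eq_0_iff)
    ultimately have "degree P \<le> degree (pderiv P)" by (rule dvd_imp_degree_le)
    thus False using dP by (simp add: degree_pderiv)
  qed
  have "pderiv ?P = map_poly of_rat (pderiv P)"
    by (simp add: poly_eq_iff coeff_pderiv coeff_map_poly of_rat_mult of_rat_add)
  hence "rsquarefree ?P"
    unfolding rsquarefree_roots
    using irreducible_no_common_root[OF assms \<open>\<not> P dvd pderiv P\<close>] by metis
  from complex_poly_decompose_rsquarefree[OF this]
  have e: "smult (lead_coeff ?P) (\<Prod>z|poly ?P z = 0. [:-z, 1:]) = ?P" .
  have nz: "?P \<noteq> 0" using \<open>P \<noteq> 0\<close> by simp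
  have "degree ?P = degree (\<Prod>z|poly ?P z = 0. [:-z, 1:])"
    by (subst e[symmetric]) (use nz in simp)
  also have "\<dots> = (\<Sum>z|poly ?P z = 0. degree [:-z, 1:])"
    by (rule degree_prod_eq_sum_degree) auto
  also have "\<dots> = card {z. poly ?P z = 0}" by simp
  finally show ?thesis by simp
qed

text \<open>The matrix \<open>M\<close> of multiplication by \<open>Q\<close> on \<open>\<int>[x]/(p)\<close> is diagonalised by the
  Vandermonde matrix \<open>V\<close> of the roots of \<open>p\<close>, so the product of the \<open>Q(z)\<close> is an integer
  determinant.\<close>

lemma prod_norm_poly_roots_ge_1:
  fixes p Q :: "int poly"
  defines "R \<equiv> {z::complex. poly (map_poly of_int p) z = 0}"
  assumes p: "lead_coeff p = 1" and card: "card R = degree p"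
    and Q: "\<And>z. z \<in> R \<Longrightarrow> poly (map_poly of_int Q) z \<noteq> 0"
  shows "(\<Prod>z\<in>R. norm (poly (map_poly of_int Q) z)) \<ge> 1"
proof -
  define d where "d = degree p"
  have "map_poly of_int p \<noteq> (0 :: complex poly)" using p by auto
  hence fin: "finite R" unfolding R_def by (rule poly_roots_finite)
  obtain zs where zs: "set zs = R" "distinct zs" using finite_distinct_list[OF fin] by blast
  have len: "length zs = d" using distinct_card[OF zs(2)] zs(1) card by (simp add: d_def)
  define r where "r = (\<lambda>j. pseudo_mod (monom 1 j * Q) p)"
  have p0: "p \<noteq> 0" using p by auto
  have r_deg: "degree (r j) < d \<or> r j = 0" for j
    using pseudo_mod(2)[OF p0, of "monom 1 j * Q"] by (auto simp: r_def d_def)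
  have r_eval: "poly (map_poly of_int (r j)) z = z ^ j * poly (map_poly of_int Q) z" if "z \<in> R" for j z
  proof -
    obtain q where q: "pseudo_divmod (monom 1 j * Q) p = (q, r j)"
      by (cases "pseudo_divmod (monom 1 j * Q) p") (simp add: r_def pseudo_mod_def)
    have "monom 1 j * Q = p * q + r j"
      using pseudo_divmod(1)[OF p0 q] p by simp
    hence "poly (map_poly of_int (monom 1 j * Q)) z = poly (map_poly of_int (p * q + r j)) z"
      by simp
    thus ?thesis using that
      by (simp add: of_int_poly_hom.hom_mult of_int_poly_hom.hom_add poly_monom R_def)
  qed
  have poly_sum: "poly f z = (\<Sum>i<d. coeff f i * z ^ i)" if "degree f < d \<or> f = 0" for f :: "complex poly" and z
  proof (cases "f = 0")
    case False
    with that have "degree f < d" by simp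
    hence "(\<Sum>i\<le>degree f. coeff f i * z ^ i) = (\<Sum>i<d. coeff f i * z ^ i)"
      by (intro sum.mono_neutral_left) (auto simp: coeff_eq_0)
    thus ?thesis by (simp add: poly_altdef)
  qed simp
  define M where "M = mat d d (\<lambda>(j,i). coeff (r j) i)"
  define V where "V = mat d d (\<lambda>(i,k). zs ! k ^ i)"
  define D where "D = mat d d (\<lambda>(i,k). if i = k then poly (map_poly of_int Q) (zs ! i) else 0)"
  define C where "C = map_mat complex_of_int M"
  have carr: "M \<in> carrier_mat d d" "V \<in> carrier_mat d d" "D \<in> carrier_mat d d" "C \<in> carrier_mat d d"
    by (simp_all add: M_def V_def D_def C_def)
  have "C * V = V * D"
  proof (rule eq_matI)
    fix j k assume jk: "j < dim_row (V * D)" "k < dim_col (V * D)"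
    hence jk: "j < d" "k < d" using carr by auto
    have zk: "zs ! k \<in> R" using jk len zs(1) nth_mem[of k zs] by simp
    have "(C * V) $$ (j, k) = (\<Sum>i<d. of_int (coeff (r j) i) * zs ! k ^ i)"
      using jk by (simp add: C_def M_def V_def scalar_prod_def atLeast0LessThan)
    also have "\<dots> = poly (map_poly of_int (r j)) (zs ! k)"
      using poly_sum[of "map_poly of_int (r j)" "zs ! k"] r_deg[of j] by auto
    also have "\<dots> = zs ! k ^ j * poly (map_poly of_int Q) (zs ! k)"
      by (rule r_eval[OF zk])
    also have "\<dots> = (\<Sum>i<d. if i = k then zs ! i ^ j * poly (map_poly of_int Q) (zs ! i) else 0)"
      using jk by (simp add: sum.delta)
    also have "\<dots> = (\<Sum>i<d. zs ! i ^ j * (if i = k then poly (map_poly of_int Q) (zs ! i) else 0))"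
      by (intro sum.cong) auto
    also have "\<dots> = (V * D) $$ (j, k)"
      using jk by (simp add: D_def V_def scalar_prod_def atLeast0LessThan)
    finally show "(C * V) $$ (j, k) = (V * D) $$ (j, k)" .
  qed (use carr in auto)
  hence "det (C * V) = det (V * D)" by (rule arg_cong)
  hence "det C * det V = det V * det D"
    unfolding det_mult[OF carr(4) carr(2)] det_mult[OF carr(2) carr(3)] .
  \<comment> \<open>A kernel vector of the transposed Vandermonde matrix would hold the coefficients
    of a nonzero polynomial \<open>f\<close> of degree below \<open>d\<close> that vanishes at all
    \<open>d\<close> roots.\<close>
  moreover have "det V \<noteq> 0"
  proof
    assume "det V = 0"
    hence "det (transpose_mat V) = 0" using det_transpose[OF carr(2)] by simp
    then obtain v where v: "v \<in> carrier_vec d" "v \<noteq> 0\<^sub>v d" "transpose_mat V *\<^sub>v v = 0\<^sub>v d"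
      using det_0_iff_vec_prod_zero[of "transpose_mat V" d] carr by auto
    define f where "f = (\<Sum>i<d. monom (v $ i) i)"
    have cf: "coeff f i = (if i < d then v $ i else 0)" for i
      by (simp add: f_def coeff_sum sum.delta)
    obtain i0 where i0: "i0 < d" "v $ i0 \<noteq> 0"
    proof -
      have "\<exists>i<d. v $ i \<noteq> 0"
      proof (rule ccontr)
        assume "\<not> (\<exists>i<d. v $ i \<noteq> 0)"
        hence "v = 0\<^sub>v d" using v(1) by (intro eq_vecI) auto
        thus False using v(2) by simp
      qed
      thus ?thesis using that by blast
    qed
    hence "f \<noteq> 0" using cf[of i0] by auto
    have "degree f < d"
      using \<open>f \<noteq> 0\<close> cf[of "degree f"] leading_coeff_neq_0[of f] by (simp split: if_splits)
    have "poly f z = 0" if zR: "z \<in> R" for z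
    proof -
      obtain k where k: "k < d" "z = zs ! k" using zR unfolding zs(1)[symmetric] in_set_conv_nth len by blast
      have "poly f z = (\<Sum>i<d. v $ i * zs ! k ^ i)" using k(2) by (simp add: f_def Polynomial.poly_sum poly_monom)
      also have "\<dots> = (transpose_mat V *\<^sub>v v) $ k"
        using k v(1) by (simp add: V_def scalar_prod_def atLeast0LessThan mult.commute)
      also have "\<dots> = 0" using v(3) k by simp
      finally show ?thesis .
    qed
    hence "card R \<le> card {z. poly f z = 0}"
      using \<open>f \<noteq> 0\<close> by (intro card_mono poly_roots_finite) auto
    also have "\<dots> \<le> degree f" using \<open>f \<noteq> 0\<close> by (rule card_poly_roots_bound)
    finally show False using \<open>degree f < d\<close> card by (simp add: d_def)
  qed
  ultimately have "det C = det D" by simp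
  moreover have "det C = of_int (det M)" unfolding C_def by simp
  moreover have "det D = (\<Prod>z\<in>R. poly (map_poly of_int Q) z)"
  proof -
    have "det D = prod_list (diag_mat D)"
      by (rule det_upper_triangular[OF _ carr(3)]) (auto simp: D_def)
    also have "\<dots> = (\<Prod>i<d. D $$ (i, i))" using carr(3) by (simp add: prod_list_diag_prod atLeast0LessThan)
    also have "\<dots> = (\<Prod>i<d. poly (map_poly of_int Q) (zs ! i))" by (intro prod.cong) (auto simp: D_def)
    also have "\<dots> = (\<Prod>z\<in>R. poly (map_poly of_int Q) z)"
      using bij_betw_nth[OF zs(2), of "{..<d}" R] zs(1) len by (intro prod.reindex_bij_betw) auto
    finally show ?thesis .
  qed
  ultimately have eq: "(\<Prod>z\<in>R. poly (map_poly of_int Q) z) = of_int (det M)" by simp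
  have "(\<Prod>z\<in>R. poly (map_poly of_int Q) z) \<noteq> 0" using Q fin by simp
  hence "det M \<noteq> 0" using eq by auto
  have "(\<Prod>z\<in>R. norm (poly (map_poly of_int Q) z)) = norm (of_int (det M) :: complex)"
    unfolding eq[symmetric] by (simp add: prod_norm)
  also have "\<dots> = of_int \<bar>det M\<bar>" by simp
  also have "\<dots> \<ge> 1" using \<open>det M \<noteq> 0\<close> by linarith
  finally show ?thesis .
qed

text \<open>The norm of \<open>Q(\<beta>)\<close> is a nonzero integer, and its factors at the other
  conjugates are at most \<open>B\<close> because these lie in the closed unit disc. So
  \<open>d\<close> can be the number of these conjugates, independently of \<open>Q\<close>.\<close>

theorem Pisot_Salem_norm_lower_bound:
  assumes "Pisot \<beta> \<or> Salem \<beta>"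
  obtains d :: nat where "\<And>(Q :: int poly) B. poly (map_poly of_int Q) \<beta> \<noteq> 0 \<Longrightarrow>
    (\<And>z::complex. norm z \<le> 1 \<Longrightarrow> norm (poly (map_poly of_int Q) z) \<le> B) \<Longrightarrow>
    \<bar>poly (map_poly of_int Q) \<beta>\<bar> * B ^ d \<ge> 1"
proof -
  have ai: "algebraic_int \<beta>" using assms by (auto simp: Pisot_def Salem_def)
  have conj: "norm z \<le> 1" if "z \<in> conjugates (of_real \<beta>)" "z \<noteq> of_real \<beta>" for z
    using assms that unfolding Pisot_def Salem_def by (elim disjE conjE) (auto intro: less_imp_le)
  obtain p :: "int poly" where p: "lead_coeff p = 1" "is_minpoly (map_poly of_int p) (of_real \<beta>)"
    by (rule algebraic_int_minpoly[OF ai])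
  define R where "R = {z::complex. poly (map_poly of_int p) z = 0}"
  have irr: "irreducible (map_poly of_int p :: rat poly)" and b: "of_real \<beta> \<in> R"
    using p(2) by (auto simp: is_minpoly_def map_poly_of_rat_of_int R_def)
  have card: "card R = degree p"
    using card_roots_irreducible[OF irr] by (simp add: R_def map_poly_of_rat_of_int degree_map_poly)
  have conjR: "norm z \<le> 1" if "z \<in> R - {of_real \<beta>}" for z
  proof -
    have "poly (map_poly of_rat (map_poly of_int p)) z = 0"
      using that by (simp add: map_poly_of_rat_of_int R_def)
    hence "z \<in> conjugates (of_real \<beta>)" using p(2) by (auto simp: conjugates_def)
    thus ?thesis using conj that by blast
  qed
  have fin: "finite R"
  proof -
    have "(map_poly of_int p :: rat poly) \<noteq> 0" using irr by (metis not_irreducible_zero)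
    hence "map_poly of_int p \<noteq> (0 :: complex poly)" by simp
    thus ?thesis unfolding R_def by (rule poly_roots_finite)
  qed
  have ofreal: "poly (map_poly of_int Q) (complex_of_real \<beta>) = of_real (poly (map_poly of_int Q) \<beta>)" for Q :: "int poly"
    by (simp add: poly_altdef degree_map_poly coeff_map_poly)
  show ?thesis
  proof (rule that[of "card (R - {of_real \<beta>})"])
    fix Q :: "int poly" and B :: real
    assume Q: "poly (map_poly of_int Q) \<beta> \<noteq> 0"
      and B: "\<And>z::complex. norm z \<le> 1 \<Longrightarrow> norm (poly (map_poly of_int Q) z) \<le> B"
    have "\<not> (map_poly of_int p :: rat poly) dvd map_poly of_int Q"
    proof
      assume "(map_poly of_int p :: rat poly) dvd map_poly of_int Q"
      then obtain S :: "rat poly" where "map_poly of_int Q = map_poly of_int p * S" by blast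
      hence "map_poly of_rat (map_poly of_int Q) = (map_poly of_rat (map_poly of_int p * S) :: complex poly)" by simp
      hence "map_poly of_int Q = (map_poly of_int p * map_poly of_rat S :: complex poly)"
        by (simp add: of_rat_poly_hom.hom_mult map_poly_of_rat_of_int)
      hence "poly (map_poly of_int Q) (complex_of_real \<beta>) = 0" using b by (simp add: R_def)
      thus False using Q ofreal[of Q] by simp
    qed
    \<comment> \<open>As the minimal polynomial does not divide \<open>Q\<close>, no conjugate of
      \<open>Q(\<beta>)\<close> vanishes.\<close>
    hence nz: "poly (map_poly of_int Q) z \<noteq> 0" if "z \<in> R" for z :: complex
      using irreducible_no_common_root[OF irr, of "map_poly of_int Q" z] that
      by (simp add: map_poly_of_rat_of_int R_def)
    have "1 \<le> (\<Prod>z\<in>R. norm (poly (map_poly of_int Q) z))"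
      unfolding R_def by (rule prod_norm_poly_roots_ge_1) (use p card nz in \<open>auto simp: R_def\<close>)
    also have "\<dots> = norm (poly (map_poly of_int Q) (complex_of_real \<beta>)) * (\<Prod>z\<in>R-{of_real \<beta>}. norm (poly (map_poly of_int Q) z))"
      by (rule prod.remove[OF fin b])
    also have "\<dots> \<le> norm (poly (map_poly of_int Q) (complex_of_real \<beta>)) * (\<Prod>z\<in>R-{of_real \<beta>}. B)"
      using B conjR by (intro mult_left_mono prod_mono) auto
    finally show "\<bar>poly (map_poly of_int Q) \<beta>\<bar> * B ^ card (R - {of_real \<beta>}) \<ge> 1"
      by (simp add: ofreal)
  qed
qed

section \<open>Tails of a vanishing expansion in base \<beta>\<close>

text \<open>This is what makes a stretch of length N^\<epsilon> long enough: geometric decay along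
  it beats every fixed power of N.\<close>

lemma eventually_poly_exp_small:
  fixes K \<epsilon> y \<kappa> :: real and E :: nat
  assumes "\<epsilon> > 0" "0 < y" "y < 1" "\<kappa> > 0" "K > 0"
  shows "eventually (\<lambda>N::nat. K * real N ^ E * y ^ nat \<lfloor>real N powr \<epsilon>\<rfloor> < \<kappa>) sequentially"
proof -
  define l where "l = - ln y"
  have l: "l > 0" using assms by (simp add: l_def)
  have "((\<lambda>N::nat. K * real N ^ E * exp (- l * (real N powr \<epsilon> - 1))) \<longlongrightarrow> 0) sequentially"
    using assms l by real_asymp
  hence "eventually (\<lambda>N::nat. K * real N ^ E * exp (- l * (real N powr \<epsilon> - 1)) < \<kappa>) sequentially"
    using assms(4) by (rule order_tendstoD)
  thus ?thesis
  proof eventually_elim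
    case (elim N)
    have "y ^ nat \<lfloor>real N powr \<epsilon>\<rfloor> = exp (- l * real (nat \<lfloor>real N powr \<epsilon>\<rfloor>))"
      using assms(2) exp_of_nat2_mult[of "ln y" "nat \<lfloor>real N powr \<epsilon>\<rfloor>"] by (simp add: l_def)
    also have "\<dots> \<le> exp (- l * (real N powr \<epsilon> - 1))"
    proof -
      have "real N powr \<epsilon> - 1 \<le> real (nat \<lfloor>real N powr \<epsilon>\<rfloor>)" by linarith
      thus ?thesis using l by simp
    qed
    finally have "K * real N ^ E * y ^ nat \<lfloor>real N powr \<epsilon>\<rfloor> \<le> K * real N ^ E * exp (- l * (real N powr \<epsilon> - 1))"
      using assms(5) by (intro mult_left_mono) auto
    thus ?case using elim by linarith
  qed
qed

text \<open>The coefficient \<open>a(n)\<close> of the expansion is \<open>P n\<close> evaluated at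
  \<beta>. The integer polynomials themselves are kept because they must also be evaluated at the
  other conjugates, where \<open>disc_bound\<close> controls them.\<close>

locale vanishing_expansion =
  fixes \<beta> :: real and d :: nat and P :: "nat \<Rightarrow> int poly" and B :: real and D :: nat
  assumes base_gt_1: "\<beta> > 1"
    and norm_bound: "\<And>(Q :: int poly) B'. poly (map_poly of_int Q) \<beta> \<noteq> 0 \<Longrightarrow>
      (\<And>z::complex. norm z \<le> 1 \<Longrightarrow> norm (poly (map_poly of_int Q) z) \<le> B') \<Longrightarrow>
      \<bar>poly (map_poly of_int Q) \<beta>\<bar> * B' ^ d \<ge> 1"
    and B: "B \<ge> 1"
    and disc_bound: "\<And>n z::complex. norm z \<le> 1 \<Longrightarrow> norm (poly (map_poly of_int (P n)) z) \<le> B * (real n + 1) ^ D"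
    and coeff_bound: "\<And>n. \<bar>poly (map_poly of_int (P n)) \<beta>\<bar> \<le> B * (real n + 1) ^ D"
    and sums_zero: "(\<lambda>n. poly (map_poly of_int (P n)) \<beta> * inverse \<beta> ^ n) sums 0"
begin

text \<open>The square root \<open>y\<close> of \<open>1/\<beta>\<close> splits \<open>\<beta> powr (- j) = y ^ j * y ^ j\<close>: one factor makes the
  polynomial weights summable, the other one provides the decay of the tail.\<close>

definition a :: "nat \<Rightarrow> real" where "a n = poly (map_poly of_int (P n)) \<beta>"

text \<open>This is \<open>Y(u)\<close> of the overview, reindexed by
  \<open>n = u + 1 + j\<close>.\<close>

definition tail :: "nat \<Rightarrow> real" where "tail u = (\<Sum>j. a (u + 1 + j) * inverse \<beta> ^ Suc j)"

definition y :: real where "y = sqrt (inverse \<beta>)"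

definition M :: real where "M = (\<Sum>j. (real j + 2) ^ D * y ^ j)"

lemma y: "0 < y" "y < 1" "y * y = inverse \<beta>"
  using base_gt_1 by (auto simp: y_def inverse_less_1_iff)

lemma summable_M: "summable (\<lambda>j. (real j + 2) ^ D * y ^ j)"
proof (rule summable_comparison_test_bigo)
  define l where "l = - ln y"
  have l: "l > 0" using y by (simp add: l_def)
  \<comment> \<open>Half the decay rate leaves room for the polynomial factor.\<close>
  show "summable (\<lambda>n. norm (exp (- l / 2 * real n)))"
  proof -
    have "exp (- l / 2 * real n) = sqrt y ^ n" for n
    proof -
      have "exp (- l / 2 * real n) = exp (ln (sqrt y) * real n)" using y by (simp add: l_def ln_sqrt)
      also have "\<dots> = exp (ln (sqrt y)) ^ n" by (simp add: exp_of_nat2_mult)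
      finally show ?thesis using y by simp
    qed
    thus ?thesis using y by (simp add: summable_geometric)
  qed
  have "(\<lambda>j. (real j + 2) ^ D * exp (- l * real j)) \<in> O(\<lambda>n. exp (- l / 2 * real n))"
    using l by real_asymp
  moreover have "exp (- l * real j) = y ^ j" for j
    using y exp_of_nat2_mult[of "ln y" j] by (simp add: l_def)
  ultimately show "(\<lambda>j. (real j + 2) ^ D * y ^ j) \<in> O(\<lambda>n. exp (- l / 2 * real n))" by simp
qed

lemma term_bound:
  "\<bar>a (u + 1 + j) * inverse \<beta> ^ Suc j\<bar> \<le> B * (real u + 1) ^ D * y ^ j * ((real j + 2) ^ D * y ^ j)"
proof -
  have "\<bar>a (u + 1 + j)\<bar> \<le> B * (real (u + 1 + j) + 1) ^ D"
    unfolding a_def by (rule coeff_bound)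
  \<comment> \<open>By \<open>u + j + 2 \<le> (u + 1) * (j + 2)\<close> the dependence on
    \<open>u\<close> separates from the weight in \<open>j\<close>.\<close>
  also have "\<dots> \<le> B * ((real u + 1) * (real j + 2)) ^ D"
    using B by (intro mult_left_mono power_mono) (auto simp: algebra_simps)
  finally have 1: "\<bar>a (u + 1 + j)\<bar> \<le> B * (real u + 1) ^ D * (real j + 2) ^ D"
    by (simp add: power_mult_distrib mult.assoc)
  have "inverse \<beta> ^ Suc j \<le> inverse \<beta> ^ j"
    using base_gt_1 by (intro power_decreasing) (auto simp: inverse_le_1_iff)
  also have "\<dots> = y ^ j * y ^ j" using y by (simp flip: power_mult_distrib)
  finally have 2: "inverse \<beta> ^ Suc j \<le> y ^ j * y ^ j" .
  have "\<bar>a (u + 1 + j) * inverse \<beta> ^ Suc j\<bar> = \<bar>a (u + 1 + j)\<bar> * inverse \<beta> ^ Suc j"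
    using base_gt_1 by (simp add: abs_mult)
  also have "\<dots> \<le> (B * (real u + 1) ^ D * (real j + 2) ^ D) * (y ^ j * y ^ j)"
    using 1 2 B base_gt_1 by (intro mult_mono) auto
  finally show ?thesis by (simp add: mult_ac)
qed

lemma term_bound_ge:
  assumes "k \<le> j"
  shows "\<bar>a (u + 1 + j) * inverse \<beta> ^ Suc j\<bar> \<le> B * (real u + 1) ^ D * y ^ k * ((real j + 2) ^ D * y ^ j)"
proof -
  have "B * (real u + 1) ^ D * y ^ j * ((real j + 2) ^ D * y ^ j) \<le> B * (real u + 1) ^ D * y ^ k * ((real j + 2) ^ D * y ^ j)"
    using y B assms by (intro mult_right_mono mult_left_mono power_decreasing) auto
  with term_bound[of u j] show ?thesis by linarith
qed

lemma summable_tail: "summable (\<lambda>j. a (u + 1 + j) * inverse \<beta> ^ Suc j)"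
  by (rule summable_comparison_test'[OF summable_mult[OF summable_M], of 0])
     (use term_bound_ge[of 0 _ u] in auto)

text \<open>Every term with \<open>j \<ge> k\<close> carries a factor
  \<open>y ^ j \<le> y ^ k\<close>; once this is pulled out, the remaining weights sum to at most
  \<open>M\<close>.\<close>

lemma tail_split:
  "\<bar>tail u - (\<Sum>j<k. a (u + 1 + j) * inverse \<beta> ^ Suc j)\<bar> \<le> B * M * (real u + 1) ^ D * y ^ k"
proof -
  let ?f = "\<lambda>j. a (u + 1 + j) * inverse \<beta> ^ Suc j"
  let ?g = "\<lambda>j. B * (real u + 1) ^ D * y ^ k * ((real j + 2) ^ D * y ^ j)"
  have g: "summable ?g" by (rule summable_mult[OF summable_M])
  have g0: "?g j \<ge> 0" for j using B y by auto
  have gk: "summable (\<lambda>j. ?g (j + k))" using g by (rule summable_ignore_initial_segment)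
  have b: "norm (?f (j + k)) \<le> ?g (j + k)" for j using term_bound_ge[of k "j + k" u] by simp
  have "tail u - (\<Sum>j<k. ?f j) = (\<Sum>j. ?f (j + k))"
    unfolding tail_def by (simp only: suminf_minus_initial_segment[OF summable_tail])
  also have "norm \<dots> \<le> (\<Sum>j. ?g (j + k))"
    using gk b by (rule norm_suminf_le[rotated])
  also have "\<dots> = (\<Sum>j. ?g j) - (\<Sum>j<k. ?g j)"
    by (rule suminf_minus_initial_segment[OF g])
  also have "\<dots> \<le> (\<Sum>j. ?g j)" using g0 by (simp add: sum_nonneg del: mult_eq_0_iff)
  also have "\<dots> = B * (real u + 1) ^ D * y ^ k * M"
    unfolding M_def by (rule suminf_mult[OF summable_M])
  finally show ?thesis by (simp add: mult_ac)
qed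

lemma tail_rec: "tail u = inverse \<beta> * (a (Suc u) + tail (Suc u))"
proof -
  let ?f = "\<lambda>j. a (u + 1 + j) * inverse \<beta> ^ Suc j"
  have "(\<Sum>j. ?f (Suc j)) = tail u - ?f 0"
    unfolding tail_def by (rule suminf_split_head[OF summable_tail])
  hence "tail u = ?f 0 + (\<Sum>j. ?f (Suc j))" by simp
  also have "(\<Sum>j. ?f (Suc j)) = inverse \<beta> * tail (Suc u)"
    unfolding tail_def by (subst suminf_mult[OF summable_tail, symmetric]) (simp add: mult_ac)
  finally show ?thesis by (simp add: algebra_simps)
qed

lemma M_pos: "M > 0"
  unfolding M_def by (rule suminf_pos[OF summable_M]) (use y in auto)

text \<open>The vanishing of the series enters as the base case, and \<open>tail_rec\<close> carries
  it upwards. The right-hand side exhibits the tail as an element of Z[\<beta>].\<close>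

lemma tail_eq: "tail u = - (\<Sum>n\<le>u. a n * \<beta> ^ (u - n))"
proof (induction u)
  case 0
  let ?f = "\<lambda>n. a n * inverse \<beta> ^ n"
  have s: "?f sums 0" using sums_zero by (simp add: a_def)
  hence "(\<Sum>n. ?f (Suc n)) = suminf ?f - ?f 0"
    by (intro suminf_split_head sums_summable)
  thus ?case using sums_unique[OF s] by (simp add: tail_def)
next
  case (Suc u)
  have "tail (Suc u) = \<beta> * tail u - a (Suc u)"
    using tail_rec[of u] base_gt_1 by (simp add: field_simps)
  also have "\<dots> = - (\<Sum>n\<le>u. a n * \<beta> ^ (Suc u - n)) - a (Suc u)"
    unfolding Suc by (simp add: sum_distrib_left Suc_diff_le mult_ac)
  finally show ?case by simp
qed

text \<open>The head is \<open>Q(\<beta>)\<close> for the polynomial \<open>Q\<close> below, whose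
  \<open>u + 1\<close> summands are each at most \<open>B * (u + 1) ^ D\<close> on the unit disc;
  the norm inequality applies to \<open>Q\<close>.\<close>

lemma tail_lower_bound:
  assumes "tail u \<noteq> 0"
  shows "1 \<le> \<bar>tail u\<bar> * (B * (real u + 1) ^ (D + 1)) ^ d"
proof -
  define Q where "Q = (\<Sum>n\<le>u. P n * monom 1 (u - n))"
  have ev: "poly (map_poly of_int Q) z = (\<Sum>n\<le>u. poly (map_poly of_int (P n)) z * z ^ (u - n))"
    for z :: "'a :: {idom, ring_char_0}"
    by (simp add: Q_def of_int_poly_hom.hom_sum of_int_poly_hom.hom_mult poly_sum poly_monom)
  have b: "norm (poly (map_poly of_int Q) z) \<le> B * (real u + 1) ^ (D + 1)" if "norm z \<le> 1" for z :: complex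
  proof -
    have "norm (poly (map_poly of_int Q) z) \<le> (\<Sum>n\<le>u. norm (poly (map_poly of_int (P n)) z * z ^ (u - n)))"
      unfolding ev by (rule norm_sum)
    also have "\<dots> \<le> (\<Sum>n\<le>u. B * (real u + 1) ^ D * 1)"
    proof (intro sum_mono)
      fix n assume "n \<in> {..u}"
      hence "B * (real n + 1) ^ D \<le> B * (real u + 1) ^ D"
        using B by (intro mult_left_mono power_mono) auto
      with disc_bound[OF that, of n] have "norm (poly (map_poly of_int (P n)) z) \<le> B * (real u + 1) ^ D" by linarith
      thus "norm (poly (map_poly of_int (P n)) z * z ^ (u - n)) \<le> B * (real u + 1) ^ D * 1"
        unfolding norm_mult norm_power using that B by (intro mult_mono power_le_one) auto
    qed
    also have "\<dots> = B * (real u + 1) ^ (D + 1)" by (simp add: algebra_simps)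
    finally show ?thesis .
  qed
  have t: "tail u = - poly (map_poly of_int Q) \<beta>" unfolding tail_eq ev by (simp add: a_def)
  hence "poly (map_poly of_int Q) \<beta> \<noteq> 0" using assms by simp
  from norm_bound[OF this b] show ?thesis using t by simp
qed

text \<open>If all coefficients in the window after \<open>u\<close> vanished,
  \<open>tail_split\<close> would make the tail exponentially small in N^\<epsilon>, against the
  polynomial lower bound.\<close>

lemma nonzero_coeff_after_nonzero_tail:
  assumes "\<epsilon> > 0"
  shows "eventually (\<lambda>N. \<forall>u<N. tail u \<noteq> 0 \<longrightarrow> (\<exists>n. u < n \<and> n \<le> u + nat \<lfloor>real N powr \<epsilon>\<rfloor> \<and> a n \<noteq> 0)) sequentially"
proof -
  have "B * M * B ^ d > 0" and "(1 :: real) > 0" using B M_pos by auto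
  \<comment> \<open>The exponent adds \<open>D\<close> from \<open>tail_split\<close> and
    \<open>(D + 1) * d\<close> from \<open>tail_lower_bound\<close>.\<close>
  from eventually_poly_exp_small[OF assms y(1,2) this(2,1), of "D + (D + 1) * d"]
  show ?thesis
  proof eventually_elim
    case (elim N)
    show ?case
    proof (intro allI impI, rule ccontr)
      fix u assume u: "u < N" "tail u \<noteq> 0"
      define k where "k = nat \<lfloor>real N powr \<epsilon>\<rfloor>"
      assume "\<not> (\<exists>n. u < n \<and> n \<le> u + nat \<lfloor>real N powr \<epsilon>\<rfloor> \<and> a n \<noteq> 0)"
      hence "a (u + 1 + j) = 0" if "j < k" for j
        using that by (auto simp: k_def dest!: spec[of _ "u + 1 + j"])
      hence "\<bar>tail u\<bar> \<le> B * M * (real u + 1) ^ D * y ^ k"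
        using tail_split[of u k] by simp
      also have "\<dots> \<le> B * M * real N ^ D * y ^ k"
        using u B M_pos y by (intro mult_left_mono mult_right_mono power_mono) auto
      finally have 1: "\<bar>tail u\<bar> \<le> B * M * real N ^ D * y ^ k" .
      have "(B * (real u + 1) ^ (D + 1)) ^ d \<le> (B * real N ^ (D + 1)) ^ d"
        using u B by (intro mult_left_mono power_mono) auto
      with 1 have "\<bar>tail u\<bar> * (B * (real u + 1) ^ (D + 1)) ^ d \<le> (B * M * real N ^ D * y ^ k) * (B * real N ^ (D + 1)) ^ d"
        using B y M_pos by (intro mult_mono) auto
      also have "\<dots> = B * M * B ^ d * real N ^ (D + (D + 1) * d) * y ^ k"
      proof -
        have "(B * real N ^ (D + 1)) ^ d = B ^ d * real N ^ ((D + 1) * d)"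
          unfolding power_mult_distrib power_mult ..
        moreover have "real N ^ (D + (D + 1) * d) = real N ^ D * real N ^ ((D + 1) * d)"
          by (rule power_add)
        ultimately show ?thesis by (simp only: mult_ac)
      qed
      also have "\<dots> < 1" unfolding k_def by (rule elim)
      finally show False using tail_lower_bound[OF u(2)] by simp
    qed
  qed
qed

text \<open>Up to the sign \<open>s\<close> of \<open>c\<close>, the coefficients between
  \<open>p\<close> and \<open>q\<close> are nonnegative, and everything from \<open>q\<close> on
  contributes less than |c| to the tail at \<open>t\<close>. The coefficient at \<open>t\<close>
  outweighs this, and \<open>tail_rec\<close> carries positivity down from \<open>t\<close> to
  \<open>p\<close>.\<close>

lemma nonzero_tail_before_isolated_coeffs:
  assumes "\<epsilon> > 0" "c \<noteq> 0"
  shows "eventually (\<lambda>N. \<forall>p t q r u. p < t \<longrightarrow> t + nat \<lfloor>real N powr \<epsilon>\<rfloor> < q \<longrightarrow> q \<le> N \<longrightarrow>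
    (\<forall>n. p < n \<longrightarrow> n < q \<longrightarrow> a n = c * r n \<and> r n \<ge> 0) \<longrightarrow> r t \<ge> 1 \<longrightarrow> p \<le> u \<longrightarrow> u < t \<longrightarrow> tail u \<noteq> 0) sequentially"
proof -
  have "B * M > 0" "\<bar>c\<bar> > 0" using B M_pos assms by auto
  from eventually_poly_exp_small[OF assms(1) y(1,2) this(2,1), of D]
  show ?thesis
  proof eventually_elim
    case (elim N)
    show ?case
    proof (intro allI impI)
      fix p t q :: nat and r :: "nat \<Rightarrow> real" and u
      assume *: "p < t" "t + nat \<lfloor>real N powr \<epsilon>\<rfloor> < q" "q \<le> N"
         "\<forall>n. p < n \<longrightarrow> n < q \<longrightarrow> a n = c * r n \<and> r n \<ge> 0" "r t \<ge> 1" "p \<le> u" "u < t"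
      define s where "s = sgn c"
      have sc: "s * c = \<bar>c\<bar>" by (simp add: s_def abs_sgn mult.commute)
      have sa: "s * a n = \<bar>c\<bar> * r n" if "p < n" "n < q" for n
        using *(4) that sc by (metis mult.assoc)
      hence sa0: "s * a n \<ge> 0" if "p < n" "n < q" for n
        unfolding sa[OF that] using that *(4) by simp
      \<comment> \<open>\<open>k\<close> counts the indices strictly between \<open>t\<close> and
        \<open>q\<close>, hence is at least the floor of N^\<epsilon>.\<close>
      define k where "k = q - t - 1"
      have "s * (\<Sum>j<k. a (t + 1 + j) * inverse \<beta> ^ Suc j) = (\<Sum>j<k. (s * a (t + 1 + j)) * inverse \<beta> ^ Suc j)"
        by (simp add: sum_distrib_left mult.assoc)
      also have "\<dots> \<ge> 0"
        using base_gt_1 * by (intro sum_nonneg mult_nonneg_nonneg sa0) (auto simp: k_def)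
      finally have 1: "s * (\<Sum>j<k. a (t + 1 + j) * inverse \<beta> ^ Suc j) \<ge> 0" .
      have "\<bar>s * (tail t - (\<Sum>j<k. a (t + 1 + j) * inverse \<beta> ^ Suc j))\<bar> \<le> B * M * (real t + 1) ^ D * y ^ k"
        using tail_split[of t k] assms by (simp add: abs_mult s_def abs_sgn_eq)
      also have "\<dots> \<le> B * M * real N ^ D * y ^ nat \<lfloor>real N powr \<epsilon>\<rfloor>"
        using * B M_pos y by (intro mult_mono mult_left_mono power_mono power_decreasing) (auto simp: k_def)
      also have "\<dots> < \<bar>c\<bar>" by (rule elim)
      finally have 2: "s * tail t > - \<bar>c\<bar>" using 1 by (simp add: algebra_simps abs_less_iff)
      have "s * tail v > 0" if "v < t" "p \<le> v" for v
        using that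
      proof (induction "t - v" arbitrary: v rule: less_induct)
        case less
        have rec: "s * tail v = inverse \<beta> * (s * a (Suc v) + s * tail (Suc v))"
          by (subst tail_rec) (simp add: algebra_simps)
        have "s * a (Suc v) + s * tail (Suc v) > 0"
        proof (cases "Suc v = t")
          case True
          have "s * a t = \<bar>c\<bar> * r t" using * by (intro sa) auto
          moreover have "\<bar>c\<bar> * r t \<ge> \<bar>c\<bar> * 1" using *(5) by (intro mult_left_mono) auto
          ultimately have "s * a t \<ge> \<bar>c\<bar>" by simp
          with 2 True show ?thesis by simp
        next
          case False
          hence "s * tail (Suc v) > 0" using less by (intro less.hyps) auto
          moreover have "s * a (Suc v) \<ge> 0" using less *(2) by (intro sa0) auto
          ultimately show ?thesis by simp
        qed
        thus ?case unfolding rec using base_gt_1 by simp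
      qed
      from this[of u] * show "tail u \<noteq> 0" by auto
    qed
  qed
qed

end

section \<open>Supports and growth of products of power series\<close>

text \<open>With nonnegative coefficients nothing cancels in the Cauchy product, so supports add as
  sets.\<close>

lemma supp_mult_nonneg:
  fixes f g :: "real fps"
  assumes "\<And>n. fps_nth f n \<ge> 0" "\<And>n. fps_nth g n \<ge> 0"
  shows "supp (f * g) = (\<lambda>(i, j). i + j) ` (supp f \<times> supp g)"
proof -
  have "fps_nth (f * g) n = 0 \<longleftrightarrow> (\<forall>i\<in>{0..n}. fps_nth f i * fps_nth g (n - i) = 0)" for n
    unfolding fps_mult_nth using assms by (intro sum_nonneg_eq_0_iff) auto
  hence *: "n \<in> supp (f * g) \<longleftrightarrow> (\<exists>i\<le>n. i \<in> supp f \<and> n - i \<in> supp g)" for n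
    by (auto simp: supp_def)
  show ?thesis
  proof (intro equalityI subsetI)
    fix n assume "n \<in> supp (f * g)"
    then obtain i where "i \<le> n" "i \<in> supp f" "n - i \<in> supp g" using * by blast
    thus "n \<in> (\<lambda>(i, j). i + j) ` (supp f \<times> supp g)"
      by (intro image_eqI[of _ _ "(i, n - i)"]) auto
  next
    fix n assume "n \<in> (\<lambda>(i, j). i + j) ` (supp f \<times> supp g)"
    then obtain i j where "n = i + j" "i \<in> supp f" "j \<in> supp g" by auto
    thus "n \<in> supp (f * g)" unfolding * by (intro exI[of _ i]) auto
  qed
qed

lemma supp_1 [simp]: "supp (1 :: 'a :: zero_neq_one fps) = {0}"
  by (auto simp: supp_def)

lemma fps_nth_mult_Nats:
  fixes f g :: "'a :: semiring_1 fps"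
  assumes "\<And>n. fps_nth f n \<in> \<nat>" "\<And>n. fps_nth g n \<in> \<nat>"
  shows "fps_nth (f * g) n \<in> \<nat>"
proof -
  have "sum h A \<in> \<nat>" if "finite A" "\<And>i. h i \<in> \<nat>" for h :: "nat \<Rightarrow> 'a" and A
    using that by induction (auto intro: Nats_add)
  thus ?thesis unfolding fps_mult_nth using assms by (auto intro: Nats_mult)
qed

lemma fps_nth_power_Nats:
  fixes f :: "'a :: semiring_1 fps"
  assumes "\<And>n. fps_nth f n \<in> \<nat>"
  shows "fps_nth (f ^ k) n \<in> \<nat>"
proof (induction k arbitrary: n)
  case (Suc k)
  show ?case unfolding power_Suc by (rule fps_nth_mult_Nats[OF assms Suc])
qed auto

lemma Nats_nonneg: "x \<in> \<nat> \<Longrightarrow> x \<ge> (0 :: real)"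
  by (auto elim: Nats_cases)

lemma card_supp_mult_le:
  fixes f g :: "real fps"
  assumes "\<And>n. fps_nth f n \<ge> 0" "\<And>n. fps_nth g n \<ge> 0"
  shows "card (supp (f * g) \<inter> {..<N}) \<le> card (supp f \<inter> {..<N}) * card (supp g \<inter> {..<N})"
proof -
  have "supp (f * g) \<inter> {..<N} \<subseteq> (\<lambda>(i, j). i + j) ` ((supp f \<inter> {..<N}) \<times> (supp g \<inter> {..<N}))"
    unfolding supp_mult_nonneg[OF assms] by auto
  hence "card (supp (f * g) \<inter> {..<N}) \<le> card ((\<lambda>(i, j). i + j) ` ((supp f \<inter> {..<N}) \<times> (supp g \<inter> {..<N})))"
    by (intro card_mono) auto
  also have "\<dots> \<le> card ((supp f \<inter> {..<N}) \<times> (supp g \<inter> {..<N}))"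
    by (rule card_image_le) auto
  finally show ?thesis by (simp add: card_cartesian_product)
qed

lemma card_supp_power_le:
  fixes f :: "real fps"
  assumes "\<And>n. fps_nth f n \<in> \<nat>"
  shows "card (supp (f ^ k) \<inter> {..<N}) \<le> card (supp f \<inter> {..<N}) ^ k"
proof (induction k)
  case 0
  have "card ({0} \<inter> {..<N}) \<le> card {0::nat}" by (rule card_mono) auto
  thus ?case by simp
next
  case (Suc k)
  have "card (supp (f * f ^ k) \<inter> {..<N}) \<le> card (supp f \<inter> {..<N}) * card (supp (f ^ k) \<inter> {..<N})"
    using assms by (intro card_supp_mult_le Nats_nonneg fps_nth_power_Nats)
  also have "\<dots> \<le> card (supp f \<inter> {..<N}) * card (supp f \<inter> {..<N}) ^ k"
    using Suc by (intro mult_left_mono) auto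
  finally show ?case by simp
qed

text \<open>Boundedness of coefficients can be lost under products, polynomial growth cannot; it
  leads to the constants \<open>B\<close> and \<open>D\<close> of the locale.\<close>

definition poly_bounded :: "real fps \<Rightarrow> bool" where
  "poly_bounded f \<longleftrightarrow> (\<exists>B D. \<forall>n. \<bar>fps_nth f n\<bar> \<le> B * (real n + 1) ^ D)"

lemma poly_bounded_mult:
  assumes "poly_bounded f" "poly_bounded g"
  shows "poly_bounded (f * g)"
proof -
  obtain B1 D1 where 1: "\<And>n. \<bar>fps_nth f n\<bar> \<le> B1 * (real n + 1) ^ D1"
    using assms(1) by (auto simp: poly_bounded_def)
  obtain B2 D2 where 2: "\<And>n. \<bar>fps_nth g n\<bar> \<le> B2 * (real n + 1) ^ D2"
    using assms(2) by (auto simp: poly_bounded_def)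
  have B: "B1 \<ge> 0" "B2 \<ge> 0" using 1[of 0] 2[of 0] by auto
  \<comment> \<open>The \<open>+ 1\<close> in the exponent pays for the \<open>n + 1\<close> terms
    of the convolution.\<close>
  have "\<bar>fps_nth (f * g) n\<bar> \<le> (B1 * B2) * (real n + 1) ^ (D1 + D2 + 1)" for n
  proof -
    have "\<bar>fps_nth (f * g) n\<bar> \<le> (\<Sum>i=0..n. \<bar>fps_nth f i * fps_nth g (n - i)\<bar>)"
      unfolding fps_mult_nth by (rule sum_abs)
    also have "\<dots> \<le> (\<Sum>i=0..n. (B1 * (real n + 1) ^ D1) * (B2 * (real n + 1) ^ D2))"
    proof (intro sum_mono)
      fix i assume i: "i \<in> {0..n}"
      have "B1 * (real i + 1) ^ D1 \<le> B1 * (real n + 1) ^ D1" "B2 * (real (n - i) + 1) ^ D2 \<le> B2 * (real n + 1) ^ D2"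
        using B i by (auto intro!: mult_left_mono power_mono)
      with 1[of i] 2[of "n - i"] have "\<bar>fps_nth f i\<bar> \<le> B1 * (real n + 1) ^ D1" "\<bar>fps_nth g (n - i)\<bar> \<le> B2 * (real n + 1) ^ D2"
        by linarith+
      thus "\<bar>fps_nth f i * fps_nth g (n - i)\<bar> \<le> (B1 * (real n + 1) ^ D1) * (B2 * (real n + 1) ^ D2)"
        unfolding abs_mult using B by (intro mult_mono) auto
    qed
    also have "\<dots> = (B1 * B2) * (real n + 1) ^ (D1 + D2 + 1)"
      by (simp add: power_add algebra_simps)
    finally show ?thesis .
  qed
  thus ?thesis unfolding poly_bounded_def by blast
qed

lemma poly_bounded_power:
  assumes "poly_bounded f"
  shows "poly_bounded (f ^ k)"
proof (induction k)
  case 0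
  show ?case unfolding poly_bounded_def by (rule exI[of _ 1], rule exI[of _ 0]) auto
next
  case (Suc k)
  thus ?case using poly_bounded_mult[OF assms] by simp
qed

lemma fps_conv_radius_ge_1_if_bounded:
  fixes f :: "real fps"
  assumes "\<And>n. \<bar>fps_nth f n\<bar> \<le> B"
  shows "fps_conv_radius f \<ge> 1"
  unfolding fps_conv_radius_def
proof (rule conv_radius_geI_ex')
  fix r :: real assume r: "0 < r" "ereal r < 1"
  have "summable (\<lambda>n. B * r ^ n)" using r by (intro summable_mult summable_geometric) auto
  thus "summable (\<lambda>n. fps_nth f n * of_real r ^ n)"
    using assms r by (elim summable_comparison_test'[where N = 0]) (auto simp: abs_mult mult_right_mono)
qed

section \<open>The exponents of the series gamma\<close>

text \<open>The coefficients are 0 or 1 even though \<open>\<gamma>\<close> is a sum over \<open>m\<close>: for \<open>\<rho> \<ge> 1\<close> the exponents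
  \<open>\<lfloor>m\<^sup>\<rho>\<rfloor>\<close> are pairwise distinct.\<close>

definition gamma_exp :: "real \<Rightarrow> nat \<Rightarrow> nat" where
  "gamma_exp \<rho> m = nat \<lfloor>real m powr \<rho>\<rfloor>"

definition gamma_fps :: "real \<Rightarrow> real fps" where
  "gamma_fps \<rho> = Abs_fps (\<lambda>n. of_bool (n \<in> range (gamma_exp \<rho>)))"

lemma supp_gamma_fps: "supp (gamma_fps \<rho>) = range (gamma_exp \<rho>)"
  by (auto simp: supp_def gamma_fps_def)

lemma gamma_fps_Nats: "fps_nth (gamma_fps \<rho>) n \<in> \<nat>"
  by (simp add: gamma_fps_def)

text \<open>Consecutive powers differ by at least 1, since
  \<open>m^\<rho> + 1 \<le> (m + 1) * m^(\<rho> - 1)\<close> for \<open>m \<ge> 1\<close>; their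
  integral parts therefore increase.\<close>

lemma strict_mono_gamma_exp:
  assumes "\<rho> \<ge> 1"
  shows "strict_mono (gamma_exp \<rho>)"
proof (rule strict_monoI_Suc)
  fix m :: nat
  have "real m powr \<rho> + 1 \<le> real (Suc m) powr \<rho>"
  proof (cases "m = 0")
    case False
    have "real m powr \<rho> + 1 \<le> real m * real m powr (\<rho> - 1) + 1 * real m powr (\<rho> - 1)"
      using False assms powr_mult_base[of "real m" "\<rho> - 1"] by (auto intro!: ge_one_powr_ge_zero)
    also have "\<dots> = real (Suc m) * real m powr (\<rho> - 1)" by (simp add: algebra_simps)
    also have "\<dots> \<le> real (Suc m) * real (Suc m) powr (\<rho> - 1)"
      using assms by (intro mult_left_mono powr_mono2) auto
    also have "\<dots> = real (Suc m) powr \<rho>" using powr_mult_base[of "real (Suc m)" "\<rho> - 1"] by simp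
    finally show ?thesis .
  qed (use assms in auto)
  hence "\<lfloor>real m powr \<rho>\<rfloor> < \<lfloor>real (Suc m) powr \<rho>\<rfloor>" by linarith
  moreover have "\<lfloor>real m powr \<rho>\<rfloor> \<ge> 0" by simp
  ultimately show "gamma_exp \<rho> m < gamma_exp \<rho> (Suc m)" unfolding gamma_exp_def by linarith
qed

lemma gamma_val_eq_eval_fps:
  assumes "\<rho> \<ge> 1"
  shows "gamma_val \<rho> x = eval_fps (gamma_fps \<rho>) x"
proof -
  have "gamma_val \<rho> x = (\<Sum>m. fps_nth (gamma_fps \<rho>) (gamma_exp \<rho> m) * x ^ gamma_exp \<rho> m)"
    by (simp add: gamma_val_def gamma_fps_def gamma_exp_def)
  also have "\<dots> = (\<Sum>n. fps_nth (gamma_fps \<rho>) n * x ^ n)"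
    using strict_mono_gamma_exp[OF assms]
    by (intro suminf_mono_reindex) (auto simp: gamma_fps_def)
  finally show ?thesis by (simp add: eval_fps_def)
qed

text \<open>Exponents below \<open>N\<close> come from \<open>m \<le> N^(1 / \<rho>)\<close>; the
  factor 2 absorbs the value \<open>m = 0\<close>.\<close>

lemma card_supp_gamma_le:
  assumes "\<rho> \<ge> 1"
  shows "real (card (supp (gamma_fps \<rho>) \<inter> {..<N})) \<le> 2 * real N powr (1 / \<rho>)"
proof (cases "N = 0")
  case False
  have "range (gamma_exp \<rho>) \<inter> {..<N} \<subseteq> gamma_exp \<rho> ` {..nat \<lfloor>real N powr (1 / \<rho>)\<rfloor>}"
  proof safe
    fix m assume "gamma_exp \<rho> m < N"
    hence "real m powr \<rho> \<le> real N" unfolding gamma_exp_def by linarith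
    hence "(real m powr \<rho>) powr (1 / \<rho>) \<le> real N powr (1 / \<rho>)"
      using assms by (intro powr_mono2) auto
    hence "real m \<le> real N powr (1 / \<rho>)" using assms by (simp add: powr_powr)
    hence "m \<le> nat \<lfloor>real N powr (1 / \<rho>)\<rfloor>" by linarith
    thus "gamma_exp \<rho> m \<in> gamma_exp \<rho> ` {..nat \<lfloor>real N powr (1 / \<rho>)\<rfloor>}" by simp
  qed
  hence "card (range (gamma_exp \<rho>) \<inter> {..<N}) \<le> card (gamma_exp \<rho> ` {..nat \<lfloor>real N powr (1 / \<rho>)\<rfloor>})"
    by (intro card_mono) auto
  also have "\<dots> \<le> nat \<lfloor>real N powr (1 / \<rho>)\<rfloor> + 1" using card_image_le[of "{..nat \<lfloor>real N powr (1 / \<rho>)\<rfloor>}" "gamma_exp \<rho>"] by simp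
  finally have "real (card (range (gamma_exp \<rho>) \<inter> {..<N})) \<le> real (nat \<lfloor>real N powr (1 / \<rho>)\<rfloor> + 1)"
    by (rule of_nat_mono)
  also have "\<dots> \<le> real N powr (1 / \<rho>) + 1" using of_nat_floor[of "real N powr (1 / \<rho>)"] by simp
  finally have "real (card (range (gamma_exp \<rho>) \<inter> {..<N})) \<le> real N powr (1 / \<rho>) + 1" .
  moreover have "real N powr (1 / \<rho>) \<ge> 1" using False assms by (intro ge_one_powr_ge_zero) auto
  ultimately show ?thesis by (simp add: supp_gamma_fps)
qed simp

lemma powr_Suc_diff_le:
  assumes "\<rho> \<ge> 1"
  shows "real (Suc m) powr \<rho> - real m powr \<rho> \<le> \<rho> * real (Suc m) powr (\<rho> - 1)"
proof (cases "m = 0")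
  case False
  have "\<exists>z. real m < z \<and> z < real (Suc m) \<and>
     real (Suc m) powr \<rho> - real m powr \<rho> = (real (Suc m) - real m) * (\<rho> * z powr (\<rho> - 1))"
    using False by (intro MVT2) (auto intro!: derivative_eq_intros)
  then obtain z where z: "real m < z" "z < real (Suc m)" "real (Suc m) powr \<rho> - real m powr \<rho> = \<rho> * z powr (\<rho> - 1)"
    by auto
  have "z powr (\<rho> - 1) \<le> real (Suc m) powr (\<rho> - 1)" using z assms by (intro powr_mono2) auto
  thus ?thesis using z(3) assms by (simp add: mult_left_mono)
qed (use assms in auto)

text \<open>The largest \<open>m\<close> with \<open>m^\<rho> \<le> x\<close> works: the next power
  is beyond \<open>x\<close>, and the spacing of powers there is of order x^(1 - 1/\<rho>). The base
  \<open>x + 1\<close> keeps the bound at least 1, which absorbs the loss from the floor.\<close>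

lemma gamma_exp_below:
  assumes "\<rho> \<ge> 1"
  shows "\<exists>s\<in>supp (gamma_fps \<rho>). s \<le> x \<and> real (x - s) \<le> (\<rho> * 2 powr (\<rho> - 1) + 1) * (real x + 1) powr (1 - 1 / \<rho>)"
proof -
  define m where "m = nat \<lfloor>real x powr (1 / \<rho>)\<rfloor>"
  have m1: "real m \<le> real x powr (1 / \<rho>)" unfolding m_def by simp
  have m2: "real x powr (1 / \<rho>) < real (Suc m)" unfolding m_def by linarith
  have "real m powr \<rho> \<le> (real x powr (1 / \<rho>)) powr \<rho>" using m1 assms by (intro powr_mono2) auto
  hence m1': "real m powr \<rho> \<le> real x" using assms by (simp add: powr_powr)
  have "(real x powr (1 / \<rho>)) powr \<rho> \<le> real (Suc m) powr \<rho>" using m2 assms by (intro powr_mono2) auto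
  hence m2': "real x \<le> real (Suc m) powr \<rho>" using assms by (simp add: powr_powr)
  have le: "gamma_exp \<rho> m \<le> x" using m1' unfolding gamma_exp_def by linarith
  have p1: "(real x + 1) powr q \<ge> 1" if "q \<ge> 0" for q using that by (intro ge_one_powr_ge_zero) auto
  have "real (x - gamma_exp \<rho> m) \<le> real x - real m powr \<rho> + 1"
    using le unfolding gamma_exp_def by linarith
  also have "\<dots> \<le> \<rho> * real (Suc m) powr (\<rho> - 1) + 1"
    using powr_Suc_diff_le[OF assms, of m] m2' by linarith
  also have "\<dots> \<le> \<rho> * (2 * (real x + 1) powr (1 / \<rho>)) powr (\<rho> - 1) + 1"
  proof -
    have "real (Suc m) \<le> real x powr (1 / \<rho>) + 1" using m1 by simp
    also have "\<dots> \<le> (real x + 1) powr (1 / \<rho>) + (real x + 1) powr (1 / \<rho>)"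
      using assms p1 by (intro add_mono powr_mono2) auto
    finally show ?thesis using assms by (intro add_right_mono mult_left_mono powr_mono2) auto
  qed
  also have "\<dots> = \<rho> * 2 powr (\<rho> - 1) * (real x + 1) powr (1 - 1 / \<rho>) + 1"
    using assms by (simp add: powr_mult powr_powr diff_divide_distrib)
  also have "\<dots> \<le> (\<rho> * 2 powr (\<rho> - 1) + 1) * (real x + 1) powr (1 - 1 / \<rho>)"
    using p1[of "1 - 1 / \<rho>"] assms by (simp add: algebra_simps)
  finally show ?thesis using le by (intro bexI[of _ "gamma_exp \<rho> m"]) (auto simp: supp_gamma_fps)
qed

text \<open>Greedy approximation: each step applies \<open>gamma_exp_below\<close> to the distance
  left over, which multiplies the exponent by \<open>1 - 1 / \<rho>\<close>. The \<open>+ 1\<close>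
  in the bound matches the base \<open>x + 1\<close> of that lemma.\<close>

lemma gamma_power_supp_below:
  assumes "\<rho> \<ge> 1"
  obtains c where "c > 0" "\<And>x N. x < N \<Longrightarrow> \<exists>s\<in>supp (gamma_fps \<rho> ^ h). s \<le> x \<and>
    real (x - s) + 1 \<le> c * real N powr ((1 - 1 / \<rho>) ^ h)"
proof -
  define \<theta> where "\<theta> = 1 - 1 / \<rho>"
  have \<theta>: "\<theta> \<ge> 0" using assms by (simp add: \<theta>_def)
  define C where "C = \<rho> * 2 powr (\<rho> - 1) + 1"
  have C: "C > 0" using assms by (auto simp: C_def intro!: add_nonneg_pos)
  have "\<exists>c>0. \<forall>x N. x < N \<longrightarrow> (\<exists>s\<in>supp (gamma_fps \<rho> ^ h). s \<le> x \<and> real (x - s) + 1 \<le> c * real N powr (\<theta> ^ h))"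
  proof (induction h)
    case 0
    show ?case by (intro exI[of _ 1]) auto
  next
    case (Suc h)
    then obtain c where c: "c > 0" "\<And>x N. x < N \<Longrightarrow> \<exists>s\<in>supp (gamma_fps \<rho> ^ h). s \<le> x \<and> real (x - s) + 1 \<le> c * real N powr (\<theta> ^ h)"
      by blast
    show ?case
    proof (intro exI conjI allI impI)
      show "C * c powr \<theta> + 1 > 0" using C c by (auto intro!: add_nonneg_pos)
      fix x N :: nat assume "x < N"
      from c(2)[OF this] obtain s where s: "s \<in> supp (gamma_fps \<rho> ^ h)" "s \<le> x" "real (x - s) + 1 \<le> c * real N powr (\<theta> ^ h)"
        by blast
      from gamma_exp_below[OF assms, of "x - s"] obtain s' where s': "s' \<in> supp (gamma_fps \<rho>)" "s' \<le> x - s"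
        "real (x - s - s') \<le> C * (real (x - s) + 1) powr \<theta>" by (auto simp: C_def \<theta>_def)
      have "s' + s \<in> supp (gamma_fps \<rho> ^ Suc h)"
        unfolding power_Suc
        by (subst supp_mult_nonneg) (use s s' in \<open>auto intro!: Nats_nonneg fps_nth_power_Nats gamma_fps_Nats\<close>)
      moreover have "real (x - (s' + s)) + 1 \<le> (C * c powr \<theta> + 1) * real N powr (\<theta> ^ Suc h)"
      proof -
        have "real (x - (s' + s)) = real (x - s - s')" by (simp add: add.commute)
        also have "\<dots> \<le> C * (real (x - s) + 1) powr \<theta>" by (rule s')
        also have "\<dots> \<le> C * (c * real N powr (\<theta> ^ h)) powr \<theta>"
          using C s \<theta> by (intro mult_left_mono powr_mono2) auto
        also have "\<dots> = C * c powr \<theta> * real N powr (\<theta> ^ Suc h)"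
          using c by (simp add: powr_mult powr_powr mult.commute)
        finally have "real (x - (s' + s)) \<le> C * c powr \<theta> * real N powr (\<theta> ^ Suc h)" .
        moreover have "real N powr (\<theta> ^ Suc h) \<ge> 1" using \<open>x < N\<close> \<theta> by (intro ge_one_powr_ge_zero) auto
        ultimately show ?thesis by (simp add: algebra_simps)
      qed
      ultimately show "\<exists>s\<in>supp (gamma_fps \<rho> ^ Suc h). s \<le> x \<and> real (x - s) + 1 \<le> (C * c powr \<theta> + 1) * real N powr (\<theta> ^ Suc h)"
        using s s' by (intro bexI[of _ "s' + s"]) auto
    qed
  qed
  thus ?thesis using that unfolding \<theta>_def by blast
qed

section \<open>The field Q(\<beta>) and common denominators\<close>

text \<open>The quotients form a subfield containing \<beta>, so the hull lies inside them.\<close>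

lemma rat_adjoin_imp_int_poly_quotient:
  assumes "x \<in> rat_adjoin \<beta>"
  obtains p q :: "int poly" where "poly (map_poly of_int q) \<beta> \<noteq> 0"
    "x = poly (map_poly of_int p) \<beta> / poly (map_poly of_int q) \<beta>"
proof -
  let ?ev = "\<lambda>p::int poly. poly (map_poly of_int p) \<beta>"
  define S where "S = {x. \<exists>p q. ?ev q \<noteq> 0 \<and> x = ?ev p / ?ev q}"
  have hom: "?ev (p * q) = ?ev p * ?ev q" "?ev (p - q) = ?ev p - ?ev q" for p q
    by (simp_all add: of_int_poly_hom.hom_mult of_int_poly_hom.hom_minus)
  have "is_subfield S"
    unfolding is_subfield_def
  proof (intro conjI ballI)
    have "?ev 1 \<noteq> 0 \<and> (1::real) = ?ev 1 / ?ev 1" by simp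
    thus "1 \<in> S" unfolding S_def by blast
  next
    fix x y assume "x \<in> S" "y \<in> S"
    then obtain p q p' q' where *: "?ev q \<noteq> 0" "x = ?ev p / ?ev q" "?ev q' \<noteq> 0" "y = ?ev p' / ?ev q'"
      by (auto simp: S_def)
    have "x - y = ?ev (p * q' - p' * q) / ?ev (q * q')" "?ev (q * q') \<noteq> 0"
      using * by (auto simp: hom diff_frac_eq)
    thus "x - y \<in> S" unfolding S_def by blast
    have "x * y = ?ev (p * p') / ?ev (q * q')"
      using * by (auto simp: hom)
    thus "x * y \<in> S" using \<open>?ev (q * q') \<noteq> 0\<close> unfolding S_def by blast
  next
    fix x assume "x \<in> S"
    then obtain p q where *: "?ev q \<noteq> 0" "x = ?ev p / ?ev q" by (auto simp: S_def)
    show "inverse x \<in> S"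
    proof (cases "?ev p = 0")
      \<comment> \<open>By the convention \<open>inverse 0 = 0\<close>, zero is its own
        inverse.\<close>
      case True
      hence "inverse x = ?ev 0 / ?ev q" using * by simp
      thus ?thesis using * unfolding S_def by blast
    next
      case False
      have "inverse x = ?ev q / ?ev p" using * by simp
      thus ?thesis using False unfolding S_def by blast
    qed
  qed
  moreover have "\<beta> = ?ev [:0, 1:] / ?ev 1" "?ev 1 \<noteq> 0" by simp_all
  hence "{\<beta>} \<subseteq> S" unfolding S_def by blast
  ultimately have "rat_adjoin \<beta> \<subseteq> S" unfolding rat_adjoin_def by (rule hull_minimal[rotated])
  hence "x \<in> S" using assms by blast
  then obtain p q where "?ev q \<noteq> 0" "x = ?ev p / ?ev q" unfolding S_def by blast
  thus ?thesis by (rule that)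
qed

lemma rat_adjoin_common_denominator:
  assumes "finite J" "\<And>i. i \<in> J \<Longrightarrow> c i \<in> rat_adjoin \<beta>"
  obtains q :: "int poly" and C :: "'i \<Rightarrow> int poly" where "poly (map_poly of_int q) \<beta> \<noteq> 0"
    "\<And>i. i \<in> J \<Longrightarrow> c i * poly (map_poly of_int q) \<beta> = poly (map_poly of_int (C i)) \<beta>"
proof -
  let ?ev = "\<lambda>p::int poly. poly (map_poly of_int p) \<beta>"
  have "\<exists>p q. ?ev q \<noteq> 0 \<and> c i = ?ev p / ?ev q" if "i \<in> J" for i
    by (rule rat_adjoin_imp_int_poly_quotient[OF assms(2)[OF that]]) blast
  hence "\<forall>i\<in>J. \<exists>p q. ?ev q \<noteq> 0 \<and> c i = ?ev p / ?ev q" by blast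
  then obtain P where "\<forall>i\<in>J. \<exists>q. ?ev q \<noteq> 0 \<and> c i = ?ev (P i) / ?ev q"
    by (rule bchoice[elim_format]) blast
  then obtain Q where PQ: "\<forall>i\<in>J. ?ev (Q i) \<noteq> 0 \<and> c i = ?ev (P i) / ?ev (Q i)"
    by (rule bchoice[elim_format]) blast
  have prod: "?ev (\<Prod>i\<in>A. Q i) = (\<Prod>i\<in>A. ?ev (Q i))" for A
    by (simp add: of_int_poly_hom.hom_prod poly_prod)
  show ?thesis
  proof (rule that[of "\<Prod>i\<in>J. Q i" "\<lambda>i. P i * (\<Prod>j\<in>J-{i}. Q j)"])
    show "?ev (\<Prod>i\<in>J. Q i) \<noteq> 0" unfolding prod using assms(1) PQ by simp
    fix i assume i: "i \<in> J"
    have "c i * ?ev (\<Prod>i\<in>J. Q i) = c i * (?ev (Q i) * ?ev (\<Prod>j\<in>J-{i}. Q j))"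
      unfolding prod by (subst prod.remove[OF assms(1) i]) simp
    also have "\<dots> = ?ev (P i) * ?ev (\<Prod>j\<in>J-{i}. Q j)" using PQ i by simp
    finally show "c i * ?ev (\<Prod>i\<in>J. Q i) = ?ev (P i * (\<Prod>j\<in>J-{i}. Q j))"
      by (simp add: of_int_poly_hom.hom_mult)
  qed
qed

section \<open>The zero \<sigma>_k and the exponent inequalities\<close>

text \<open>This is \<open>G_k(X)\<close> divided by \<open>X\<close>: with the zero at 0 removed,
  the function is strictly increasing on [0,1] for \<open>k \<ge> 2\<close>.\<close>

definition G_quot :: "nat \<Rightarrow> real \<Rightarrow> real" where
  "G_quot k x = real k - 1 - (\<Sum>i<k. (1 - x) ^ i)"

lemma G_poly_eq: "G_poly k x = x * G_quot k x"
proof -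
  have "1 - (1 - x) ^ k = x * (\<Sum>i<k. (1 - x) ^ i)"
    using one_diff_power_eq[of "1 - x" k] by simp
  thus ?thesis by (simp add: G_poly_def G_quot_def algebra_simps)
qed

lemma G_quot_strict_mono:
  assumes "k \<ge> 2" "0 \<le> x" "x < y" "y \<le> 1"
  shows "G_quot k x < G_quot k y"
proof -
  have "(\<Sum>i<k. (1 - y) ^ i) < (\<Sum>i<k. (1 - x) ^ i)"
  proof (rule sum_strict_mono_ex1)
    show "\<forall>i\<in>{..<k}. (1 - y) ^ i \<le> (1 - x) ^ i" using assms by (intro ballI power_mono) auto
    show "\<exists>i\<in>{..<k}. (1 - y) ^ i < (1 - x) ^ i" using assms by (intro bexI[of _ 1]) auto
  qed auto
  thus ?thesis by (simp add: G_quot_def)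
qed

text \<open>The quotient rises strictly from -1 at 0 to \<open>k - 2\<close> at 1. So the zero
  exists and is unique, which justifies the definite description.\<close>

lemma sigma_zero_bounds:
  assumes "k \<ge> 3"
  shows "0 < sigma_zero k" "sigma_zero k < 1" "G_quot k (sigma_zero k) = 0"
proof -
  have "(\<Sum>i<k. (0::real) ^ i) = (\<Sum>i<k. if i = 0 then 1 else 0)" by (intro sum.cong) auto
  hence G1: "G_quot k 1 > 0" using assms by (simp add: G_quot_def)
  have G0: "G_quot k 0 < 0" by (simp add: G_quot_def)
  have "\<exists>x\<ge>0. x \<le> 1 \<and> G_quot k x = 0"
  proof (rule IVT'[of "G_quot k" 0 0 1])
    show "continuous_on {0..1} (G_quot k)" unfolding G_quot_def by (intro continuous_intros)
  qed (use G0 G1 in auto)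
  then obtain x where x: "0 \<le> x" "x \<le> 1" "G_quot k x = 0" by blast
  hence x: "0 < x" "x < 1" "G_quot k x = 0" using G0 G1 by (auto simp: order_less_le)
  have "sigma_zero k = x"
    unfolding sigma_zero_def
  proof (rule the_equality)
    show "0 < x \<and> x < 1 \<and> G_poly k x = 0" using x by (simp add: G_poly_eq)
    fix y assume "0 < y \<and> y < 1 \<and> G_poly k y = 0"
    hence y: "0 < y" "y < 1" "G_quot k y = 0" by (auto simp: G_poly_eq)
    show "y = x"
      using G_quot_strict_mono[of k x y] G_quot_strict_mono[of k y x] assms x y
      by (cases x y rule: linorder_cases) auto
  qed
  thus "0 < sigma_zero k" "sigma_zero k < 1" "G_quot k (sigma_zero k) = 0" using x by auto
qed

text \<open>This says \<open>G_k(1 / k) \<ge> 0\<close> and so puts \<sigma>_k at or below 1/k. As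
  (1 + 1/(k - 1))^(k - 1) \<le> e \<le> 3, its reciprocal (1 - 1/k)^(k - 1) is at least 1/3, and the
  remaining factor is at least 3/4.\<close>

lemma one_minus_inverse_power_ge:
  assumes "k \<ge> 4"
  shows "(1 - 1 / real k) ^ k \<ge> 1 / real k"
proof -
  define n where "n = real k - 1"
  have n: "n \<ge> 3" "real k = n + 1" using assms by (auto simp: n_def)
  have "(1 + 1 / n) ^ (k - 1) \<le> exp (1 / n) ^ (k - 1)"
    using n by (intro power_mono exp_ge_add_one_self) auto
  also have "\<dots> = exp (real (k - 1) * (1 / n))" by (simp only: exp_of_nat_mult)
  also have "real (k - 1) * (1 / n) = 1" using assms n by (simp add: of_nat_diff)
  also have "exp (1::real) \<le> 3" by (rule exp_le)
  finally have le: "(1 + 1 / n) ^ (k - 1) \<le> 3" .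
  have "1 / 3 \<le> 1 / (1 + 1 / n) ^ (k - 1)"
  proof -
    have "(1 + 1 / n) ^ (k - 1) > 0" using n by (intro zero_less_power) (simp add: add_pos_pos)
    thus ?thesis using le by (intro divide_left_mono) auto
  qed
  also have "\<dots> = (1 - 1 / real k) ^ (k - 1)"
  proof -
    have "1 - 1 / real k = 1 / (1 + 1 / n)" using n by (simp add: field_simps)
    thus ?thesis by (simp add: power_one_over)
  qed
  finally have "1 / 3 \<le> (1 - 1 / real k) ^ (k - 1)" .
  hence "(3 / 4) * (1 / 3) \<le> (1 - 1 / real k) * (1 - 1 / real k) ^ (k - 1)"
    using n by (intro mult_mono) (auto simp: field_simps)
  also have "\<dots> = (1 - 1 / real k) ^ k" using assms by (simp flip: power_Suc)
  finally have "1 / 4 \<le> (1 - 1 / real k) ^ k" by simp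
  moreover have "1 / real k \<le> 1 / 4" using assms by (intro divide_left_mono) auto
  ultimately show ?thesis by linarith
qed

text \<open>The leading power \<open>h\<close> of gamma may be smaller than \<open>A\<close>.
  Passing from \<open>h + 1\<close> down to \<open>h\<close> divides by \<open>1 - x\<close>, and
  \<open>1 - h * x \<le> (1 - x) * (1 - (h - 1) * x)\<close> for \<open>h \<ge> 1\<close>.\<close>

lemma gap_exponent_decreasing:
  fixes x :: real
  assumes "0 < x" "x < 1" "(1 - x) ^ k + (real k - 1) * x < 1" "h \<le> k"
  shows "(1 - x) ^ h + (real h - 1) * x < 1"
  using assms(4)
proof (induction h rule: inc_induct)
  case base
  show ?case by (rule assms(3))
next
  case (step h)
  show ?case
  proof (cases "h = 0")
    case False
    have "(1 - x) * (1 - x) ^ h < 1 - real h * x" using step.IH by simp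
    also have "\<dots> \<le> (1 - x) * (1 - (real h - 1) * x)"
    proof -
      have "(real h - 1) * (x * x) \<ge> 0" using False assms by simp
      thus ?thesis by (simp add: algebra_simps)
    qed
    finally have "(1 - x) ^ h < 1 - (real h - 1) * x" using assms by simp
    thus ?thesis by simp
  qed (use assms in simp)
qed

text \<open>With \<open>x = 1 / \<rho>\<close> the last inequality is \<open>G_h(x) < 0\<close>. At
  \<open>h = A\<close> it follows by direct estimates for \<open>A \<le> 3\<close>, and from
  \<open>x\<close> lying below \<sigma>_A for \<open>A \<ge> 4\<close>; smaller \<open>h\<close> are
  reached by descent.\<close>

lemma gap_exponents:
  assumes "A > 0" "A \<le> 3 \<Longrightarrow> \<rho> > real A" "A \<ge> 4 \<Longrightarrow> \<rho> > inverse (sigma_zero A)" "h \<le> A"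
  shows "\<rho> > 1" "real h / \<rho> < 1" "(1 - 1 / \<rho>) ^ h + (real h - 1) * (1 / \<rho>) < 1"
proof -
  have *: "\<rho> > real A \<and> (1 - 1 / \<rho>) ^ A + (real A - 1) * (1 / \<rho>) < 1"
  proof (cases "A \<le> 3")
    case True
    hence \<rho>: "\<rho> > real A" by (rule assms(2))
    define x where "x = 1 / \<rho>"
    have x: "0 < x" "x * real A < 1" using \<rho> assms(1) by (simp_all add: x_def divide_less_eq)
    from True assms(1) consider "A = 1" | "A = 2" | "A = 3" by linarith
    hence "(1 - x) ^ A + (real A - 1) * x < 1"
    proof cases
      case 2
      have "x * x < x * 1" using x 2 by (intro mult_strict_left_mono) auto
      thus ?thesis using 2 by (simp add: power2_eq_square algebra_simps)
    next
      case 3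
      have "3 * x < 1" using x 3 by simp
      moreover have "x * x > 0" using x by simp
      ultimately have "3 * x - x * x < 1" by linarith
      hence "x * (3 * x - x * x) < x * 1" using x by (intro mult_strict_left_mono)
      thus ?thesis using 3 by (simp add: power3_eq_cube algebra_simps)
    qed (use x in auto)
    thus ?thesis using \<rho> by (simp add: x_def)
  next
    case False
    hence A: "A \<ge> 4" by simp
    note s = sigma_zero_bounds[of A]
    have \<rho>: "\<rho> > inverse (sigma_zero A)" using A by (rule assms(3))
    \<comment> \<open>The sign of \<open>G_A\<close> at 1/A gives \<sigma>_A \<le> 1/A, so the
      hypothesis also yields \<open>\<rho> > A\<close>.\<close>
    have "G_poly A (1 / real A) \<ge> 0"
    proof -
      have "(real A - 1) * (1 / real A) = 1 - 1 / real A" using A by (simp add: field_simps)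
      thus ?thesis using one_minus_inverse_power_ge[OF A] by (simp add: G_poly_def)
    qed
    hence "G_quot A (1 / real A) \<ge> 0" using A unfolding G_poly_eq by (simp add: zero_le_divide_iff)
    hence "sigma_zero A \<le> 1 / real A"
      using G_quot_strict_mono[of A "sigma_zero A" "1 / real A"] G_quot_strict_mono[of A "1 / real A" "sigma_zero A"] s A
      by (cases "sigma_zero A" "1 / real A" rule: linorder_cases) auto
    hence "inverse (sigma_zero A) \<ge> real A"
      using le_imp_inverse_le[of "sigma_zero A" "1 / real A"] s A by simp
    hence \<rho>A: "\<rho> > real A" using \<rho> by linarith
    have "inverse \<rho> < sigma_zero A" using less_imp_inverse_less[OF \<rho>] s A by simp
    hence "1 / \<rho> < sigma_zero A" unfolding inverse_eq_divide .
    hence "G_quot A (1 / \<rho>) < 0"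
      using G_quot_strict_mono[of A "1 / \<rho>" "sigma_zero A"] s A \<rho>A by simp
    hence "G_poly A (1 / \<rho>) < 0" unfolding G_poly_eq using \<rho>A by (intro mult_pos_neg) auto
    thus ?thesis using \<rho>A by (simp add: G_poly_def)
  qed
  thus "\<rho> > 1" using assms(1) by linarith
  show "real h / \<rho> < 1" using * assms(4) \<open>\<rho> > 1\<close> by (simp add: divide_less_eq)
  show "(1 - 1 / \<rho>) ^ h + (real h - 1) * (1 / \<rho>) < 1"
    by (rule gap_exponent_decreasing[OF _ _ conjunct2[OF *] assms(4)]) (use \<open>\<rho> > 1\<close> in simp_all)
qed

section \<open>Counting along gaps\<close>

text \<open>Cut [0, N) at the points of \<open>T\<close> and charge each gap to its left endpoint:
  \<open>l\<close> if that lies in \<open>T'\<close>, \<open>L\<close> otherwise. The parts of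
  \<open>Z\<close> in different gaps are disjoint, so their counts add up.\<close>

lemma gap_covering_bound:
  fixes T T' Z :: "nat set" and L l K :: real
  assumes "0 \<in> T" "L \<ge> 0" "l \<ge> 0" "K \<ge> 0"
    and gap: "\<And>p q. p \<in> T \<Longrightarrow> p < q \<Longrightarrow> q \<le> N \<Longrightarrow> (\<And>n. p < n \<Longrightarrow> n < q \<Longrightarrow> n \<notin> T) \<Longrightarrow>
      real (q - p) \<le> (if p \<in> T' then l else L) + K * real (card (Z \<inter> {p..<q}))"
  shows "real N \<le> real (card (T \<inter> {..<N})) * L + real (card (T' \<inter> {..<N})) * l + K * real (card (Z \<inter> {..<N}))"
proof -
  \<comment> \<open>Removing the last gap, from \<open>p\<close> to \<open>m\<close>, leaves the
    same claim for \<open>p\<close>. Since \<open>gap\<close> does not ask for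
    \<open>q \<in> T\<close>, it also covers an incomplete gap at the end.\<close>
  have "real m \<le> real (card (T \<inter> {..<m})) * L + real (card (T' \<inter> {..<m})) * l + K * real (card (Z \<inter> {..<m}))"
    if "m \<le> N" for m
    using that
  proof (induction m rule: less_induct)
    case (less m)
    show ?case
    proof (cases "m = 0")
      case False
      define p where "p = Max (T \<inter> {..<m})"
      have "p \<in> T \<inter> {..<m}" unfolding p_def using False assms(1) by (intro Max_in) auto
      hence p: "p \<in> T" "p < m" by auto
      have pmax: "n \<notin> T" if "p < n" "n < m" for n
      proof
        assume "n \<in> T"
        hence "n \<le> p" unfolding p_def using that by (intro Max_ge) auto
        thus False using that by simp
      qed
      have "real m = real p + real (m - p)" using p by simp
      also have "\<dots> \<le> (real (card (T \<inter> {..<p})) * L + real (card (T' \<inter> {..<p})) * l + K * real (card (Z \<inter> {..<p})))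
         + ((if p \<in> T' then l else L) + K * real (card (Z \<inter> {p..<m})))"
        using less p pmax by (intro add_mono gap less.IH) auto
      also have "\<dots> \<le> real (card (T \<inter> {..<m})) * L + real (card (T' \<inter> {..<m})) * l + K * real (card (Z \<inter> {..<m}))"
      proof -
        have split: "{..<m} = {..<p} \<union> {p..<m}" using p by auto
        have Z: "card (Z \<inter> {..<m}) = card (Z \<inter> {..<p}) + card (Z \<inter> {p..<m})"
          unfolding split Int_Un_distrib by (rule card_Un_disjoint) auto
        have ins: "card (A \<inter> {..<p}) + (if p \<in> A then 1 else 0) \<le> card (A \<inter> {..<m})" for A
        proof (cases "p \<in> A")
          case True
          have "card (insert p (A \<inter> {..<p})) \<le> card (A \<inter> {..<m})" using p True by (intro card_mono) auto
          thus ?thesis using True by simp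
        next
          case False
          have "card (A \<inter> {..<p}) \<le> card (A \<inter> {..<m})" using p by (intro card_mono) auto
          thus ?thesis using False by simp
        qed
        have "real (card (T \<inter> {..<p}) + 1) * L \<le> real (card (T \<inter> {..<m})) * L"
          using ins[of T] p assms(2) by (intro mult_right_mono of_nat_mono) auto
        moreover have "real (card (T' \<inter> {..<p}) + (if p \<in> T' then 1 else 0)) * l \<le> real (card (T' \<inter> {..<m})) * l"
          using ins[of T'] assms(3) by (intro mult_right_mono of_nat_mono) auto
        ultimately show ?thesis using assms(2,3) by (simp add: Z algebra_simps split: if_splits)
      qed
      finally show ?thesis .
    qed simp
  qed
  thus ?thesis by simp
qed

text \<open>Each element of \<open>W\<close> serves at most \<open>k\<close> elements of
  \<open>Z\<close>, and as \<open>k \<le> N\<close> only elements of \<open>W\<close> below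
  \<open>2 * N\<close> are reached.\<close>

lemma card_le_by_following_elements:
  fixes Z W :: "nat set"
  assumes "\<And>u. u \<in> Z \<Longrightarrow> u < N \<Longrightarrow> \<exists>n\<in>W. u < n \<and> n \<le> u + k" "k \<le> N"
  shows "card (Z \<inter> {..<N}) \<le> k * card (W \<inter> {..<2 * N})"
proof -
  have "Z \<inter> {..<N} \<subseteq> (\<Union>n\<in>W \<inter> {..<2 * N}. {n - k..<n})"
  proof
    fix u assume u: "u \<in> Z \<inter> {..<N}"
    then obtain n where "n \<in> W" "u < n" "n \<le> u + k" using assms(1) by blast
    thus "u \<in> (\<Union>n\<in>W \<inter> {..<2 * N}. {n - k..<n})" using u assms(2) by (intro UN_I[of n]) auto
  qed
  hence "card (Z \<inter> {..<N}) \<le> card (\<Union>n\<in>W \<inter> {..<2 * N}. {n - k..<n})" by (intro card_mono) auto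
  also have "\<dots> \<le> (\<Sum>n\<in>W \<inter> {..<2 * N}. card {n - k..<n})" by (rule card_UN_le) auto
  also have "\<dots> \<le> of_nat (card (W \<inter> {..<2 * N})) * k" by (rule sum_bounded_above) auto
  finally show ?thesis by (simp add: mult.commute)
qed

lemma eventually_powr_less_linear:
  fixes K s :: real
  assumes "s < 1"
  shows "eventually (\<lambda>N::nat. K * real N powr s < real N / 2) sequentially"
proof -
  have "((\<lambda>N::nat. K * real N powr (s - 1)) \<longlongrightarrow> 0) sequentially" using assms by real_asymp
  hence "eventually (\<lambda>N::nat. K * real N powr (s - 1) < 1 / 2) sequentially" by (rule order_tendstoD) simp
  thus ?thesis using eventually_gt_at_top[of 0]
  proof eventually_elim
    case (elim N)
    have "K * real N powr s = K * real N powr (s - 1) * real N"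
      using elim powr_mult_base[of "real N" "s - 1"] by (simp add: mult.commute)
    also have "\<dots> < 1 / 2 * real N" using elim by (intro mult_strict_right_mono) auto
    finally show ?case by simp
  qed
qed

section \<open>The class F and the supports of monomials\<close>

lemma class_F_Nats: "g \<in> class_F \<Longrightarrow> fps_nth g n \<in> \<nat>"
  by (simp add: class_F_def)

lemma class_F_bounded:
  assumes "g \<in> class_F"
  obtains B where "\<And>n. \<bar>fps_nth g n\<bar> \<le> B"
proof -
  obtain B where "\<And>n. fps_nth g n \<le> B" using assms by (auto simp: class_F_def)
  thus ?thesis using that[of B] Nats_nonneg[OF class_F_Nats[OF assms]] by auto
qed

lemma class_F_card_le:
  assumes "g \<in> class_F" "\<epsilon> > 0"
  shows "eventually (\<lambda>N. real (card (supp g \<inter> {..<N})) \<le> real N powr \<epsilon>) sequentially"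
proof -
  have "(\<lambda>R. real (count_below (supp g) R)) \<in> o[at_top](\<lambda>R. R powr \<epsilon>)"
    using assms by (auto simp: class_F_def)
  hence "eventually (\<lambda>R. norm (real (count_below (supp g) R)) \<le> 1 * norm (R powr \<epsilon>)) at_top"
    by (rule landau_o.smallD) simp
  from eventually_compose_filterlim[OF this filterlim_real_sequentially]
  have "eventually (\<lambda>N. norm (real (count_below (supp g) (real N))) \<le> 1 * norm (real N powr \<epsilon>)) sequentially" .
  moreover have "count_below (supp g) (real N) = card (supp g \<inter> {..<N})" for N
    unfolding count_below_def by (rule arg_cong[of _ _ card]) auto
  ultimately show ?thesis by simp
qed

lemma class_F_supp_interval:
  assumes "g \<in> class_F"
  obtains C R where "C \<ge> 1" "R \<ge> 1" "\<And>r. r \<ge> R \<Longrightarrow> \<exists>n\<in>supp g. r \<le> real n \<and> real n \<le> C * r"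
proof -
  obtain C0 where C0: "\<forall>\<^sub>F r in at_top. \<exists>n\<in>supp g. r \<le> real n \<and> real n \<le> C0 * r"
    using assms by (auto simp: class_F_def)
  then obtain R0 where R0: "\<And>r. r \<ge> R0 \<Longrightarrow> \<exists>n\<in>supp g. r \<le> real n \<and> real n \<le> C0 * r"
    by (auto simp: eventually_at_top_linorder)
  show ?thesis
  proof (rule that[of "max C0 1" "max R0 1"])
    fix r assume r: "r \<ge> max R0 1"
    then obtain n where n: "n \<in> supp g" "r \<le> real n" "real n \<le> C0 * r" using R0 by auto
    moreover have "C0 * r \<le> max C0 1 * r" using r by (intro mult_right_mono) auto
    ultimately show "\<exists>n\<in>supp g. r \<le> real n \<and> real n \<le> max C0 1 * r" by (intro bexI[of _ n]) auto
  qed auto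
qed

definition mono_supp :: "real \<Rightarrow> real fps \<Rightarrow> nat \<times> nat \<Rightarrow> nat set" where
  "mono_supp \<rho> g = (\<lambda>(i, j). supp (gamma_fps \<rho> ^ i * g ^ j))"

text \<open>Each factor gamma contributes N^(1/\<rho>) up to a constant, and the factors
  \<open>g\<close> together only an arbitrarily small power of N.\<close>

lemma mono_supp_card_le:
  assumes "g \<in> class_F" "\<rho> > 1" "\<epsilon> > 0"
  shows "eventually (\<lambda>N. real (card (mono_supp \<rho> g (i, j) \<inter> {..<N})) \<le> real N powr (real i / \<rho> + \<epsilon>)) sequentially"
proof -
  \<comment> \<open>With this \<delta> the \<open>j\<close> factors \<open>g\<close> cost at most
    N^(\<epsilon>/2); the other half of \<epsilon> pays for the constant
    \<open>2 ^ i\<close>.\<close>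
  define \<delta> where "\<delta> = \<epsilon> / (2 * (real j + 1))"
  have \<delta>: "\<delta> > 0" "\<delta> * real j \<le> \<epsilon> / 2" using assms by (auto simp: \<delta>_def field_simps)
  have "filterlim (\<lambda>N::nat. real N powr (\<epsilon> / 2)) at_top sequentially" using assms by real_asymp
  hence "eventually (\<lambda>N::nat. 2 ^ i \<le> real N powr (\<epsilon> / 2)) sequentially"
    unfolding filterlim_at_top by blast
  with class_F_card_le[OF assms(1) \<delta>(1)] show ?thesis
    using eventually_ge_at_top[of 1]
  proof eventually_elim
    case (elim N)
    have "card (mono_supp \<rho> g (i, j) \<inter> {..<N}) \<le> card (supp (gamma_fps \<rho> ^ i) \<inter> {..<N}) * card (supp (g ^ j) \<inter> {..<N})"
      unfolding mono_supp_def prod.case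
      by (intro card_supp_mult_le Nats_nonneg fps_nth_power_Nats gamma_fps_Nats class_F_Nats[OF assms(1)])
    also have "\<dots> \<le> card (supp (gamma_fps \<rho>) \<inter> {..<N}) ^ i * card (supp g \<inter> {..<N}) ^ j"
      by (intro mult_mono card_supp_power_le gamma_fps_Nats class_F_Nats[OF assms(1)]) auto
    finally have "real (card (mono_supp \<rho> g (i, j) \<inter> {..<N})) \<le>
        real (card (supp (gamma_fps \<rho>) \<inter> {..<N})) ^ i * real (card (supp g \<inter> {..<N})) ^ j"
      by (simp only: of_nat_le_iff flip: of_nat_mult of_nat_power)
    also have "\<dots> \<le> (2 * real N powr (1 / \<rho>)) ^ i * (real N powr \<delta>) ^ j"
      using elim assms by (intro mult_mono power_mono card_supp_gamma_le) auto
    also have "\<dots> = 2 ^ i * real N powr (real i / \<rho> + \<delta> * real j)"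
      using elim by (simp add: power_mult_distrib powr_add powr_powr flip: powr_realpow) 
    also have "\<dots> \<le> real N powr (\<epsilon> / 2) * real N powr (real i / \<rho> + \<epsilon> / 2)"
      using elim \<delta> by (intro mult_mono powr_mono) auto
    also have "\<dots> = real N powr (real i / \<rho> + \<epsilon>)" by (simp add: add.commute flip: powr_add)
    finally show ?case .
  qed
qed

lemma UN_mono_supp_card_le:
  assumes "g \<in> class_F" "\<rho> > 1" "\<epsilon> > 0" "finite I" "\<And>i j. (i, j) \<in> I \<Longrightarrow> real i / \<rho> \<le> e"
  shows "eventually (\<lambda>N. real (card ((\<Union>k\<in>I. mono_supp \<rho> g k) \<inter> {..<N})) \<le> real N powr (e + \<epsilon>)) sequentially"
proof -
  have "\<forall>k\<in>I. eventually (\<lambda>N. real (card (mono_supp \<rho> g k \<inter> {..<N})) \<le> real N powr (real (fst k) / \<rho> + \<epsilon> / 2)) sequentially"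
    using mono_supp_card_le[OF assms(1,2), of "\<epsilon> / 2"] assms(3) by auto
  hence "eventually (\<lambda>N. \<forall>k\<in>I. real (card (mono_supp \<rho> g k \<inter> {..<N})) \<le> real N powr (real (fst k) / \<rho> + \<epsilon> / 2)) sequentially"
    by (rule eventually_ball_finite[OF assms(4)])
  moreover have "filterlim (\<lambda>N::nat. real N powr (\<epsilon> / 2)) at_top sequentially" using assms by real_asymp
  hence "eventually (\<lambda>N::nat. real (card I) \<le> real N powr (\<epsilon> / 2)) sequentially"
    unfolding filterlim_at_top by blast
  ultimately show ?thesis using eventually_ge_at_top[of 1]
  proof eventually_elim
    case (elim N)
    have "card ((\<Union>k\<in>I. mono_supp \<rho> g k) \<inter> {..<N}) = card (\<Union>k\<in>I. mono_supp \<rho> g k \<inter> {..<N})"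
      by (rule arg_cong[of _ _ card]) auto
    also have "\<dots> \<le> (\<Sum>k\<in>I. card (mono_supp \<rho> g k \<inter> {..<N}))" by (rule card_UN_le[OF assms(4)])
    finally have "real (card ((\<Union>k\<in>I. mono_supp \<rho> g k) \<inter> {..<N})) \<le> (\<Sum>k\<in>I. real (card (mono_supp \<rho> g k \<inter> {..<N})))"
      by (simp only: of_nat_le_iff flip: of_nat_sum)
    also have "\<dots> \<le> (\<Sum>k\<in>I. real N powr (e + \<epsilon> / 2))"
    proof (intro sum_mono)
      fix k assume k: "k \<in> I"
      have "real N powr (real (fst k) / \<rho> + \<epsilon> / 2) \<le> real N powr (e + \<epsilon> / 2)"
        using assms(5)[of "fst k" "snd k"] k elim by (intro powr_mono) auto
      thus "real (card (mono_supp \<rho> g k \<inter> {..<N})) \<le> real N powr (e + \<epsilon> / 2)" using elim k by force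
    qed
    also have "\<dots> = real (card I) * real N powr (e + \<epsilon> / 2)" by simp
    also have "\<dots> \<le> real N powr (\<epsilon> / 2) * real N powr (e + \<epsilon> / 2)" using elim by (intro mult_right_mono) auto
    also have "\<dots> = real N powr (e + \<epsilon>)" by (simp add: add.commute flip: powr_add)
    finally show ?case .
  qed
qed

text \<open>In the application \<open>e = h / \<rho>\<close>, \<open>e' = (h - 1) / \<rho>\<close>
  and \<open>\<tau> = (1 - 1 / \<rho>) ^ h\<close>. Inserting the counts into
  \<open>gap_covering_bound\<close> bounds N by terms of order N^(e + 2\<epsilon>) and N^(e' +
  \<tau> + \<epsilon>), both of exponent below 1.\<close>

lemma gap_growth_contradiction:
  fixes T T' Z W :: "nat set" and C R c \<epsilon> e e' \<tau> :: real
  assumes pos: "C \<ge> 1" "R \<ge> 1" "c > 0" "\<epsilon> > 0"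
    and e: "0 \<le> e" "e' \<le> e" "e + 2 * \<epsilon> < 1" "e' + \<tau> + \<epsilon> < 1"
    and T0: "0 \<in> T"
    and cT: "eventually (\<lambda>N. real (card (T \<inter> {..<N})) \<le> real N powr (e + \<epsilon>)) sequentially"
    and cT': "eventually (\<lambda>N. real (card (T' \<inter> {..<N})) \<le> real N powr (e' + \<epsilon>)) sequentially"
    and cW: "eventually (\<lambda>N. real (card (W \<inter> {..<N})) \<le> real N powr (e + \<epsilon>)) sequentially"
    and Z: "eventually (\<lambda>N. \<forall>u<N. u \<in> Z \<longrightarrow> (\<exists>n\<in>W. u < n \<and> n \<le> u + nat \<lfloor>real N powr \<epsilon>\<rfloor>)) sequentially"
    and gap: "eventually (\<lambda>N. \<forall>p q. p \<in> T \<longrightarrow> p < q \<longrightarrow> q \<le> N \<longrightarrow> (\<forall>n. p < n \<longrightarrow> n < q \<longrightarrow> n \<notin> T) \<longrightarrow>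
       real (q - p) \<le> (if p \<in> T' then 2 * (real N powr \<epsilon> + 2 + c * real N powr \<tau>) else 2 * C * R + 2 * real N powr \<epsilon>)
         + 2 * C * real (card (Z \<inter> {p..<q}))) sequentially"
  shows False
proof -
  \<comment> \<open>\<open>K1\<close> collects the constants in front of N^(e + 2\<epsilon>):
    \<open>2 * C * R + 2\<close> from \<open>L\<close>, \<open>6\<close> as 2 + 4 from
    \<open>l\<close>, and the last summand from \<open>Z\<close>.\<close>
  define K1 where "K1 = 2 * C * R + 2 + 6 + 2 * C * 2 powr (e + \<epsilon>)"
  have "filterlim (\<lambda>N::nat. 2 * N) sequentially sequentially"
    by (rule filterlim_subseq) (auto simp: strict_mono_def)
  from eventually_compose_filterlim[OF cW this]
  have cW2: "eventually (\<lambda>N. real (card (W \<inter> {..<2 * N})) \<le> real (2 * N) powr (e + \<epsilon>)) sequentially" .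
  have "eventually (\<lambda>N::nat. False) sequentially"
    using cT cT' cW2 Z gap eventually_powr_less_linear[OF e(3), of K1]
      eventually_powr_less_linear[OF e(4), of "2 * c"] eventually_ge_at_top[of 1]
  proof eventually_elim
    case (elim N)
    define k where "k = nat \<lfloor>real N powr \<epsilon>\<rfloor>"
    have N: "real N \<ge> 1" using elim by simp
    have sq: "real N powr (2 * \<epsilon>) = real N powr \<epsilon> * real N powr \<epsilon>" unfolding mult_2 powr_add ..
    have k: "real k \<le> real N powr \<epsilon>" unfolding k_def by simp
    have "real N powr \<epsilon> \<le> real N powr 1" using N e pos by (intro powr_mono) auto
    hence "k \<le> N" using k N by simp
    have "card (Z \<inter> {..<N}) \<le> k * card (W \<inter> {..<2 * N})"
      using elim(4) \<open>k \<le> N\<close> by (intro card_le_by_following_elements) (auto simp: k_def)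
    hence "real (card (Z \<inter> {..<N})) \<le> real k * real (card (W \<inter> {..<2 * N}))"
      by (simp only: of_nat_le_iff flip: of_nat_mult)
    also have "\<dots> \<le> real N powr \<epsilon> * real (2 * N) powr (e + \<epsilon>)"
      using k elim(3) by (intro mult_mono) auto
    also have "\<dots> = 2 powr (e + \<epsilon>) * real N powr (e + 2 * \<epsilon>)"
      by (simp add: powr_mult powr_add sq)
    finally have cZ: "real (card (Z \<inter> {..<N})) \<le> 2 powr (e + \<epsilon>) * real N powr (e + 2 * \<epsilon>)" .
    have mono: "real N powr s \<le> real N powr t" if "s \<le> t" for s t
      using N that by (intro powr_mono) auto
    define l where "l = 2 * (real N powr \<epsilon> + 2 + c * real N powr \<tau>)"
    define L where "L = 2 * C * R + 2 * real N powr \<epsilon>"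
    have lL: "l \<ge> 0" "L \<ge> 0" using pos by (auto simp: l_def L_def)
    have "real N \<le> real (card (T \<inter> {..<N})) * L + real (card (T' \<inter> {..<N})) * l + 2 * C * real (card (Z \<inter> {..<N}))"
      using T0 lL pos elim(5) unfolding l_def L_def by (intro gap_covering_bound) auto
    also have "\<dots> \<le> real N powr (e + \<epsilon>) * L + real N powr (e' + \<epsilon>) * l + 2 * C * (2 powr (e + \<epsilon>) * real N powr (e + 2 * \<epsilon>))"
      using elim(1,2) cZ lL pos by (intro add_mono mult_right_mono mult_left_mono) auto
    also have "\<dots> = 2 * C * R * real N powr (e + \<epsilon>) + 2 * real N powr (e + 2 * \<epsilon>) + (2 * real N powr (e' + 2 * \<epsilon>)
       + 4 * real N powr (e' + \<epsilon>) + 2 * c * real N powr (e' + \<tau> + \<epsilon>)) + 2 * C * 2 powr (e + \<epsilon>) * real N powr (e + 2 * \<epsilon>)"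
      unfolding l_def L_def powr_add sq by (simp add: algebra_simps)
    also have "\<dots> \<le> 2 * C * R * real N powr (e + 2 * \<epsilon>) + 2 * real N powr (e + 2 * \<epsilon>) + (2 * real N powr (e + 2 * \<epsilon>)
       + 4 * real N powr (e + 2 * \<epsilon>) + 2 * c * real N powr (e' + \<tau> + \<epsilon>)) + 2 * C * 2 powr (e + \<epsilon>) * real N powr (e + 2 * \<epsilon>)"
      using pos e by (intro add_mono mult_left_mono mono order_refl) auto
    also have "\<dots> = K1 * real N powr (e + 2 * \<epsilon>) + 2 * c * real N powr (e' + \<tau> + \<epsilon>)"
      by (simp add: K1_def algebra_simps)
    also have "\<dots> < real N / 2 + real N / 2" using elim(6,7) by (intro add_strict_mono)
    finally show ?case by simp
  qed
  thus False by simp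
qed

section \<open>The contradiction from a nontrivial relation\<close>

lemma lexicographic_maximum:
  fixes J :: "(nat \<times> nat) set"
  assumes "finite J" "J \<noteq> {}"
  obtains h b where "(h, b) \<in> J" "\<And>i j. (i, j) \<in> J \<Longrightarrow> i < h \<or> i = h \<and> j < b \<or> (i, j) = (h, b)"
proof -
  define h where "h = Max (fst ` J)"
  have h: "h \<in> fst ` J" unfolding h_def using assms by (intro Max_in) auto
  define b where "b = Max (snd ` {k\<in>J. fst k = h})"
  have "b \<in> snd ` {k\<in>J. fst k = h}" unfolding b_def using assms h by (intro Max_in) auto
  hence "(h, b) \<in> J" by auto
  moreover have "i < h \<or> i = h \<and> j < b \<or> (i, j) = (h, b)" if "(i, j) \<in> J" for i j
  proof -
    have "i \<le> h" unfolding h_def using assms that by (intro Max_ge) force+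
    moreover have "j \<le> b" if "i = h" unfolding b_def using assms that \<open>(i, j) \<in> J\<close> by (intro Max_ge) force+
    ultimately show ?thesis by force
  qed
  ultimately show ?thesis by (rule that)
qed

lemma eval_fps_monomial_sums:
  fixes f g :: "real fps"
  assumes "fps_conv_radius f \<ge> 1" "fps_conv_radius g \<ge> 1" "\<bar>x\<bar> < 1"
  shows "(\<lambda>n. fps_nth (f ^ i * g ^ j) n * x ^ n) sums (eval_fps f x ^ i * eval_fps g x ^ j)"
proof -
  have x: "ereal (norm x) < 1" using assms by simp
  have f: "ereal (norm x) < fps_conv_radius f" and g: "ereal (norm x) < fps_conv_radius g"
    by (rule less_le_trans[OF x assms(1)], rule less_le_trans[OF x assms(2)])
  have fi: "ereal (norm x) < fps_conv_radius (f ^ i)" using f fps_conv_radius_power[of f i] by (rule less_le_trans)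
  have gj: "ereal (norm x) < fps_conv_radius (g ^ j)" using g fps_conv_radius_power[of g j] by (rule less_le_trans)
  have "ereal (norm x) < fps_conv_radius (f ^ i * g ^ j)"
    using fi gj fps_conv_radius_mult[of "f ^ i" "g ^ j"] by (metis less_le_trans min_less_iff_conj)
  from sums_eval_fps[OF this] show ?thesis
    using f g fi gj by (simp add: eval_fps_mult eval_fps_power)
qed

lemma Ints_floor_of_Nats: "x \<in> \<nat> \<Longrightarrow> real_of_int \<lfloor>x\<rfloor> = x"
  by (elim Nats_cases) simp

lemma norm_poly_of_int_le:
  fixes z :: complex and p :: "int poly"
  assumes "norm z \<le> 1"
  shows "norm (poly (map_poly of_int p) z) \<le> (\<Sum>i\<le>degree p. \<bar>real_of_int (coeff p i)\<bar>)"
proof -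
  have "norm (poly (map_poly of_int p) z) \<le> (\<Sum>i\<le>degree p. norm (of_int (coeff p i) * z ^ i))"
    unfolding poly_altdef by (simp add: degree_map_poly coeff_map_poly norm_sum)
  also have "\<dots> \<le> (\<Sum>i\<le>degree p. \<bar>real_of_int (coeff p i)\<bar>)"
    using assms by (intro sum_mono) (auto simp: norm_mult norm_power intro!: mult_left_le power_le_one)
  finally show ?thesis .
qed

text \<open>The relation is turned into an instance of \<open>vanishing_expansion\<close>. What then
  remains is to bound each gap of \<open>T\<close>, separately for left endpoints inside and outside
  \<open>T'\<close>.\<close>

lemma gamma_monomials_no_relation:
  fixes J :: "(nat \<times> nat) set" and C :: "nat \<times> nat \<Rightarrow> int poly" and \<rho> \<beta> :: real and g :: "real fps"
  assumes J: "finite J" "J \<noteq> {}"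
    and C0: "\<And>k. k \<in> J \<Longrightarrow> poly (map_poly of_int (C k)) \<beta> \<noteq> 0"
    and \<rho>: "\<rho> > 1"
    and expo: "\<And>i j. (i, j) \<in> J \<Longrightarrow> real i / \<rho> < 1"
      "\<And>i j. (i, j) \<in> J \<Longrightarrow> (1 - 1 / \<rho>) ^ i + (real i - 1) * (1 / \<rho>) < 1"
    and g: "g \<in> class_F"
    and \<beta>: "Pisot \<beta> \<or> Salem \<beta>"
    and rel: "(\<Sum>k\<in>J. poly (map_poly of_int (C k)) \<beta> *
      (gamma_val \<rho> (inverse \<beta>) ^ fst k * eval_fps g (inverse \<beta>) ^ snd k)) = 0"
  shows False
proof -
  have \<beta>1: "\<beta> > 1" using \<beta> by (auto simp: Pisot_def Salem_def)
  define x where "x = inverse \<beta>"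
  have x: "\<bar>x\<bar> < 1" using \<beta>1 by (simp add: x_def inverse_less_1_iff)
  let ?F = "gamma_fps \<rho>"
  define r where "r = (\<lambda>k n. fps_nth (?F ^ fst k * g ^ snd k) n)"
  have r_Nats: "r k n \<in> \<nat>" for k n
    unfolding r_def by (intro fps_nth_mult_Nats fps_nth_power_Nats gamma_fps_Nats class_F_Nats[OF g])
  have r_nonneg: "r k n \<ge> 0" for k n by (rule Nats_nonneg[OF r_Nats])
  have r_ge_1: "r k n \<ge> 1" if "r k n \<noteq> 0" for k n
    using r_Nats[of k n] that by (auto elim!: Nats_cases)
  have r_supp: "n \<in> mono_supp \<rho> g k \<longleftrightarrow> r k n \<noteq> 0" for k n
    by (auto simp: mono_supp_def r_def supp_def split: prod.splits)
  obtain Bg where Bg: "\<And>n. \<bar>fps_nth g n\<bar> \<le> Bg" using class_F_bounded[OF g] by blast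
  have F1: "\<bar>fps_nth ?F n\<bar> \<le> 1" for n by (simp add: gamma_fps_def)
  have r_sums: "(\<lambda>n. r k n * x ^ n) sums (gamma_val \<rho> x ^ fst k * eval_fps g x ^ snd k)" for k
    unfolding r_def using gamma_val_eq_eval_fps[of \<rho> x] \<rho>
      eval_fps_monomial_sums[OF fps_conv_radius_ge_1_if_bounded[OF F1] fps_conv_radius_ge_1_if_bounded[OF Bg] x] by simp
  have "poly_bounded ?F" "poly_bounded g"
    unfolding poly_bounded_def using F1 Bg by (metis mult.right_neutral power_0)+
  hence "\<forall>k. poly_bounded (?F ^ fst k * g ^ snd k)" by (intro allI poly_bounded_mult poly_bounded_power)
  hence "\<exists>Br Dr. \<forall>k n. \<bar>r k n\<bar> \<le> Br k * (real n + 1) ^ Dr k"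
    unfolding poly_bounded_def r_def by metis
  then obtain Br :: "nat \<times> nat \<Rightarrow> real" and Dr where rb: "\<And>k n. \<bar>r k n\<bar> \<le> Br k * (real n + 1) ^ Dr k" by blast
  have Br0: "Br k \<ge> 0" for k using rb[of k 0] by simp
  \<comment> \<open>The \<open>r k n\<close> are natural numbers stored as reals; the floor makes
    them integers without changing their value.\<close>
  define P where "P = (\<lambda>n. \<Sum>k\<in>J. [:\<lfloor>r k n\<rfloor>:] * C k)"
  have evP: "poly (map_poly of_int (P n)) z = (\<Sum>k\<in>J. of_int \<lfloor>r k n\<rfloor> * poly (map_poly of_int (C k)) z)"
    for n and z :: "'a :: {idom, ring_char_0}"
  proof -
    have "poly (map_poly of_int ([:m:] * p)) z = of_int m * poly (map_poly of_int p) z" for m and p :: "int poly"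
      unfolding of_int_poly_hom.hom_mult poly_mult by (cases "m = 0") (auto simp: map_poly_def)
    thus ?thesis unfolding P_def of_int_poly_hom.hom_sum poly_sum by (rule sum.cong[OF refl])
  qed
  define c where "c = (\<lambda>k. poly (map_poly of_int (C k)) \<beta>)"
  have aP: "poly (map_poly of_int (P n)) \<beta> = (\<Sum>k\<in>J. r k n * c k)" for n
    unfolding evP c_def by (simp add: Ints_floor_of_Nats[OF r_Nats])
  \<comment> \<open>\<open>S k\<close> dominates \<open>C k\<close> both on the unit disc and at
    \<beta>, so a single \<open>B\<close> serves for both bounds of the locale; the summand 1 in
    \<open>B\<close> secures \<open>B \<ge> 1\<close>.\<close>
  define S where "S = (\<lambda>k. (\<Sum>i\<le>degree (C k). \<bar>real_of_int (coeff (C k) i)\<bar>) + \<bar>c k\<bar>)"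
  have S0: "S k \<ge> 0" for k by (simp add: S_def sum_nonneg)
  define B where "B = 1 + (\<Sum>k\<in>J. Br k * S k)"
  define D where "D = (\<Sum>k\<in>J. Dr k)"
  have bound: "(\<Sum>k\<in>J. r k n * S k) \<le> B * (real n + 1) ^ D" for n
  proof -
    have "(\<Sum>k\<in>J. r k n * S k) \<le> (\<Sum>k\<in>J. (Br k * (real n + 1) ^ D) * S k)"
    proof (intro sum_mono mult_right_mono S0)
      fix k assume "k \<in> J"
      hence "Dr k \<le> D" unfolding D_def using J by (intro member_le_sum) auto
      hence "Br k * (real n + 1) ^ Dr k \<le> Br k * (real n + 1) ^ D"
        using Br0 by (intro mult_left_mono power_increasing) auto
      thus "r k n \<le> Br k * (real n + 1) ^ D" using rb[of k n] by linarith
    qed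
    also have "\<dots> = (\<Sum>k\<in>J. Br k * S k) * (real n + 1) ^ D"
      unfolding sum_distrib_right by (intro sum.cong) auto
    also have "\<dots> \<le> B * (real n + 1) ^ D" unfolding B_def by (intro mult_right_mono) auto
    finally show ?thesis .
  qed
  obtain d where d: "\<And>(Q :: int poly) B'. poly (map_poly of_int Q) \<beta> \<noteq> 0 \<Longrightarrow>
    (\<And>z::complex. norm z \<le> 1 \<Longrightarrow> norm (poly (map_poly of_int Q) z) \<le> B') \<Longrightarrow>
    \<bar>poly (map_poly of_int Q) \<beta>\<bar> * B' ^ d \<ge> 1"
    using Pisot_Salem_norm_lower_bound[OF \<beta>] by blast
  interpret V: vanishing_expansion \<beta> d P B D
  proof
    show "\<beta> > 1" by fact
    show "1 \<le> \<bar>poly (map_poly of_int Q) \<beta>\<bar> * B' ^ d"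
      if "poly (map_poly of_int Q) \<beta> \<noteq> 0" "\<And>z::complex. norm z \<le> 1 \<Longrightarrow> norm (poly (map_poly of_int Q) z) \<le> B'" for Q B'
      using that by (rule d)
    show "B \<ge> 1" unfolding B_def using Br0 S0 by (simp add: sum_nonneg)
    show "norm (poly (map_poly of_int (P n)) z) \<le> B * (real n + 1) ^ D" if "norm z \<le> 1" for n and z :: complex
    proof -
      have "norm (poly (map_poly of_int (P n)) z) \<le> (\<Sum>k\<in>J. norm (of_int \<lfloor>r k n\<rfloor> * poly (map_poly of_int (C k)) z))"
        unfolding evP by (rule norm_sum)
      also have "\<dots> \<le> (\<Sum>k\<in>J. r k n * S k)"
      proof (intro sum_mono)
        fix k
        have 1: "norm (of_int \<lfloor>r k n\<rfloor> :: complex) = r k n"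
          using r_nonneg[of k n] by (simp add: Ints_floor_of_Nats[OF r_Nats])
        have 2: "norm (poly (map_poly of_int (C k)) z) \<le> S k"
          unfolding S_def using norm_poly_of_int_le[OF that, of "C k"] by simp
        show "norm (of_int \<lfloor>r k n\<rfloor> * poly (map_poly of_int (C k)) z) \<le> r k n * S k"
          unfolding norm_mult 1 by (rule mult_left_mono[OF 2 r_nonneg])
      qed
      finally show ?thesis using bound[of n] by linarith
    qed
    show "\<bar>poly (map_poly of_int (P n)) \<beta>\<bar> \<le> B * (real n + 1) ^ D" for n
    proof -
      have "\<bar>poly (map_poly of_int (P n)) \<beta>\<bar> \<le> (\<Sum>k\<in>J. \<bar>r k n * c k\<bar>)" unfolding aP by (rule sum_abs)
      also have "\<dots> \<le> (\<Sum>k\<in>J. r k n * S k)"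
        using r_nonneg by (intro sum_mono) (auto simp: abs_mult S_def sum_nonneg intro!: mult_left_mono)
      finally show ?thesis using bound[of n] by linarith
    qed
    have "(\<lambda>n. \<Sum>k\<in>J. c k * (r k n * x ^ n)) sums (\<Sum>k\<in>J. c k * (gamma_val \<rho> x ^ fst k * eval_fps g x ^ snd k))"
      by (intro sums_sum sums_mult r_sums)
    also have "(\<Sum>k\<in>J. c k * (gamma_val \<rho> x ^ fst k * eval_fps g x ^ snd k)) = 0"
      using rel by (simp add: c_def x_def)
    finally show "(\<lambda>n. poly (map_poly of_int (P n)) \<beta> * inverse \<beta> ^ n) sums 0"
      unfolding aP by (simp add: sum_distrib_right sum_distrib_left x_def mult_ac)
  qed
  have a: "V.a n = (\<Sum>k\<in>J. r k n * c k)" for n unfolding V.a_def by (rule aP)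
  obtain h b where hb: "(h, b) \<in> J" "\<And>i j. (i, j) \<in> J \<Longrightarrow> i < h \<or> i = h \<and> j < b \<or> (i, j) = (h, b)"
    using lexicographic_maximum[OF J] by blast
  define E where "E = Max (snd ` J)"
  have E: "j \<le> E" if "(i, j) \<in> J" for i j
    unfolding E_def using J that by (intro Max_ge) force+
  \<comment> \<open>\<open>I'\<close> has the smaller powers of gamma, and \<open>I\<close> adds
    gamma^h with smaller powers of \<open>g\<close>. All such pairs are taken, even outside
    \<open>J\<close>, so that one more factor \<open>g\<close> leads from \<open>(h, j)\<close> with
    \<open>j < b\<close> back into \<open>I\<close> or to \<open>(h, b)\<close>.\<close>
  define I' where "I' = {..<h} \<times> {..E}"
  define I where "I = I' \<union> {h} \<times> {..<b}"
  define T where "T = (\<Union>k\<in>I. mono_supp \<rho> g k)"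
  define T' where "T' = (\<Union>k\<in>I'. mono_supp \<rho> g k)"
  define W where "W = (\<Union>k\<in>insert (h, b) I. mono_supp \<rho> g k)"
  have JI: "k \<in> I" if "k \<in> J - {(h, b)}" for k
    using that hb(2)[of "fst k" "snd k"] E[of "fst k" "snd k"] by (cases k) (auto simp: I_def I'_def)
  have a_lead: "V.a n = c (h, b) * r (h, b) n" if "n \<notin> T" for n
  proof -
    have "V.a n = r (h, b) n * c (h, b) + (\<Sum>k\<in>J - {(h, b)}. r k n * c k)"
      unfolding a by (rule sum.remove) (use J hb in auto)
    also have "(\<Sum>k\<in>J - {(h, b)}. r k n * c k) = 0"
      using that JI r_supp unfolding T_def by (intro sum.neutral) auto
    finally show ?thesis by simp
  qed
  have a_W: "n \<in> W" if "V.a n \<noteq> 0" for n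
    using that a_lead[of n] r_supp[of n "(h, b)"] by (auto simp: W_def T_def)
  have c0: "c (h, b) \<noteq> 0" using C0[OF hb(1)] by (simp add: c_def)
  have fin: "finite I" "finite I'" by (auto simp: I_def I'_def)
  have zero_F: "0 \<in> supp (?F ^ i)" for i
  proof (induction i)
    case (Suc i)
    have "gamma_exp \<rho> 0 = 0" by (simp add: gamma_exp_def)
    hence "0 \<in> supp ?F" unfolding supp_gamma_fps by (metis rangeI)
    with Suc show ?case unfolding power_Suc
      by (subst supp_mult_nonneg) (auto intro!: Nats_nonneg fps_nth_power_Nats gamma_fps_Nats image_eqI[of _ _ "(0, 0)"])
  qed simp
  \<comment> \<open>With no smaller monomial, \<open>(h, b)\<close> would be \<open>(0, 0)\<close>
    and the relation would consist of its nonzero coefficient alone.\<close>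
  have "I \<noteq> {}"
  proof
    assume "I = {}"
    hence "b = 0" "h = 0" by (auto simp: I_def I'_def)
    moreover have "J = {(h, b)}" using JI hb(1) \<open>I = {}\<close> by auto
    ultimately show False using rel C0[OF hb(1)] by simp
  qed
  \<comment> \<open>The support of \<open>g\<close> need not contain 0, so a pure power of gamma
    supplies \<open>0 \<in> T\<close>.\<close>
  hence "(h, 0) \<in> I \<or> (0, 0) \<in> I" by (auto simp: I_def I'_def)
  hence T0: "0 \<in> T" unfolding T_def mono_supp_def using zero_F[of h] by (auto intro: bexI[rotated])

  define \<tau> where "\<tau> = (1 - 1 / \<rho>) ^ h"
  define e where "e = real h / \<rho>"
  \<comment> \<open>For \<open>h = 0\<close> this exponent is negative; then \<open>I'\<close> and
    \<open>T'\<close> are empty.\<close>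
  define e' where "e' = (real h - 1) * (1 / \<rho>)"
  have ex: "0 \<le> e" "e' \<le> e" "e < 1" "e' + \<tau> < 1"
    using expo(1)[OF hb(1)] expo(2)[OF hb(1)] \<rho> by (auto simp: e_def e'_def \<tau>_def field_simps)
  define \<epsilon> where "\<epsilon> = min (1 - e) (1 - (e' + \<tau>)) / 4"
  have \<epsilon>: "\<epsilon> > 0" "e + 2 * \<epsilon> < 1" "e' + \<tau> + \<epsilon> < 1"
  proof -
    have "4 * \<epsilon> \<le> 1 - e" "4 * \<epsilon> \<le> 1 - (e' + \<tau>)" "\<epsilon> > 0" using ex by (auto simp: \<epsilon>_def)
    thus "\<epsilon> > 0" "e + 2 * \<epsilon> < 1" "e' + \<tau> + \<epsilon> < 1" by linarith+
  qed
  obtain Cg R where CR: "Cg \<ge> 1" "R \<ge> 1" "\<And>r. r \<ge> R \<Longrightarrow> \<exists>n\<in>supp g. r \<le> real n \<and> real n \<le> Cg * r"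
    using class_F_supp_interval[OF g] by blast
  obtain q0 where q0: "q0 > 0" "\<And>x N. x < N \<Longrightarrow> \<exists>s\<in>supp (?F ^ h). s \<le> x \<and> real (x - s) + 1 \<le> q0 * real N powr \<tau>"
    using gamma_power_supp_below[of \<rho> h] \<rho> unfolding \<tau>_def by (metis less_imp_le)
  define Z where "Z = {u. V.tail u \<noteq> 0}"

  show False
  proof (rule gap_growth_contradiction[where T = T and T' = T' and Z = Z and W = W])
    show "eventually (\<lambda>N. real (card (T \<inter> {..<N})) \<le> real N powr (e + \<epsilon>)) sequentially"
      unfolding T_def using g \<rho> \<epsilon> fin
      by (intro UN_mono_supp_card_le) (auto simp: I_def I'_def e_def divide_right_mono)
    show "eventually (\<lambda>N. real (card (T' \<inter> {..<N})) \<le> real N powr (e' + \<epsilon>)) sequentially"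
      unfolding T'_def using g \<rho> \<epsilon> fin
      by (intro UN_mono_supp_card_le) (auto simp: I'_def e'_def intro!: divide_right_mono)
    show "eventually (\<lambda>N. real (card (W \<inter> {..<N})) \<le> real N powr (e + \<epsilon>)) sequentially"
      unfolding W_def using g \<rho> \<epsilon> fin
      by (intro UN_mono_supp_card_le) (auto simp: I_def I'_def e_def divide_right_mono)
    show "eventually (\<lambda>N. \<forall>u<N. u \<in> Z \<longrightarrow> (\<exists>n\<in>W. u < n \<and> n \<le> u + nat \<lfloor>real N powr \<epsilon>\<rfloor>)) sequentially"
      using V.nonzero_coeff_after_nonzero_tail[OF \<epsilon>(1)]
      by eventually_elim (use a_W in \<open>force simp: Z_def\<close>)
    show "eventually (\<lambda>N. \<forall>p q. p \<in> T \<longrightarrow> p < q \<longrightarrow> q \<le> N \<longrightarrow> (\<forall>n. p < n \<longrightarrow> n < q \<longrightarrow> n \<notin> T) \<longrightarrow>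
       real (q - p) \<le> (if p \<in> T' then 2 * (real N powr \<epsilon> + 2 + q0 * real N powr \<tau>) else 2 * Cg * R + 2 * real N powr \<epsilon>)
         + 2 * Cg * real (card (Z \<inter> {p..<q}))) sequentially"
      using V.nonzero_tail_before_isolated_coeffs[OF \<epsilon>(1) c0]
    proof eventually_elim
      case (elim N)
      define k where "k = nat \<lfloor>real N powr \<epsilon>\<rfloor>"
      have k: "real k \<le> real N powr \<epsilon>" unfolding k_def by simp
      show ?case
      proof (intro allI impI)
        fix p q assume p: "p \<in> T" and pq: "p < q" "q \<le> N" and gap: "\<forall>n. p < n \<longrightarrow> n < q \<longrightarrow> n \<notin> T"
        \<comment> \<open>Every index from \<open>p\<close> up to a suitable support point
          \<open>t\<close> lies in \<open>Z\<close>, so it suffices to find \<open>t\<close> a fixed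
          proportion into the gap.\<close>
        have card_Z: "real (t - p) \<le> real (card (Z \<inter> {p..<q}))"
          if t: "p < t" "t + k < q" "t \<in> mono_supp \<rho> g (h, b)" for t
        proof -
          have "r (h, b) t \<ge> 1" using t(3) r_ge_1 unfolding r_supp by blast
          moreover have "\<forall>n. p < n \<longrightarrow> n < q \<longrightarrow> V.a n = c (h, b) * r (h, b) n \<and> r (h, b) n \<ge> 0"
            using gap a_lead r_nonneg by blast
          ultimately have "u \<in> Z" if "p \<le> u" "u < t" for u
            using elim[rule_format, of p t q "r (h, b)" u] t pq that unfolding Z_def k_def by blast
          hence "{p..<t} \<subseteq> Z \<inter> {p..<q}" using t by auto
          hence "card {p..<t} \<le> card (Z \<inter> {p..<q})" by (intro card_mono) auto
          thus ?thesis by simp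
        qed
        have card_nonneg: "2 * Cg * real (card (Z \<inter> {p..<q})) \<ge> 0" using CR by simp
        show "real (q - p) \<le> (if p \<in> T' then 2 * (real N powr \<epsilon> + 2 + q0 * real N powr \<tau>) else 2 * Cg * R + 2 * real N powr \<epsilon>)
         + 2 * Cg * real (card (Z \<inter> {p..<q}))"
        proof (cases "p \<in> T'")
          case True
          show ?thesis
          proof (cases "real (q - p) \<le> 2 * (real N powr \<epsilon> + 2 + q0 * real N powr \<tau>)")
            case False
            have "q0 * real N powr \<tau> \<ge> 0" using q0 by simp
            moreover have "real k \<ge> 0" by simp
            ultimately have "real k + 1 < real (q - p)" using False k by argo
            hence "k + 1 < q - p" by linarith
            \<comment> \<open>Aiming at \<open>q - 1 - k\<close> keeps \<open>t\<close> at the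
              required distance from \<open>q\<close>. As the gap is long compared with the
              approximation error, \<open>t\<close> does not fall before its midpoint.\<close>
            define y where "y = q - 1 - k"
            have "y < N" using pq \<open>k + 1 < q - p\<close> by (simp add: y_def)
            from q0(2)[OF this] obtain t where t: "t \<in> supp (?F ^ h)" "t \<le> y" "real (y - t) + 1 \<le> q0 * real N powr \<tau>"
              by blast
            have "real y = real q - 1 - real k" using \<open>k + 1 < q - p\<close> by (simp add: y_def of_nat_diff)
            hence tq: "real q - real t \<le> real k + q0 * real N powr \<tau>" using t by (simp add: of_nat_diff)
            hence half: "real (q - p) / 2 \<le> real t - real p" using False k pq by (simp add: of_nat_diff)
            hence pt: "p < t" using pq by (simp add: of_nat_diff)
            have tk: "t + k < q" using t(2) \<open>k + 1 < q - p\<close> by (simp add: y_def)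
            \<comment> \<open>For \<open>b > 0\<close> the point \<open>t\<close>, lying in the
              support of gamma^h, would be a point of \<open>T\<close> inside the gap. So long gaps
              of this kind force \<open>b = 0\<close>.\<close>
            have "b = 0"
            proof (rule ccontr)
              assume "b \<noteq> 0"
              hence "(h, 0) \<in> I" by (auto simp: I_def)
              hence "t \<in> T" unfolding T_def mono_supp_def using t(1) by (intro UN_I[of "(h, 0)"]) auto
              thus False using gap pt tk by auto
            qed
            hence "t \<in> mono_supp \<rho> g (h, b)" using t(1) by (simp add: mono_supp_def)
            from card_Z[OF pt tk this] have "real (q - p) \<le> 2 * real (card (Z \<inter> {p..<q}))"
              using half pt by (simp add: of_nat_diff)
            also have "\<dots> \<le> 2 * Cg * real (card (Z \<inter> {p..<q}))"
              using CR by (intro mult_right_mono) auto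
            finally have "real (q - p) \<le> 2 * Cg * real (card (Z \<inter> {p..<q}))" .
            moreover have "0 \<le> 2 * (real N powr \<epsilon> + 2 + q0 * real N powr \<tau>)" using q0 by simp
            ultimately show ?thesis using True by simp
          qed (use True card_nonneg in auto)
        next
          case False
          show ?thesis
          proof (cases "real (q - p) \<le> 2 * Cg * R + 2 * real N powr \<epsilon>")
            case long: False
            obtain j where j: "j < b" "p \<in> mono_supp \<rho> g (h, j)"
              using p False by (auto simp: T_def T'_def I_def)
            \<comment> \<open>An element \<open>n\<close> of the support of \<open>g\<close> between
              \<open>s\<close> and \<open>Cg * s\<close> is at most half the gap, yet at least a
              fixed proportion of it; this is the origin of the factor
              \<open>2 * Cg\<close>.\<close>
            define s where "s = real (q - p) / (2 * Cg)"
            have "2 * Cg * R \<le> real (q - p)" using long by (smt (verit) powr_ge_zero)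
            hence "s \<ge> R" using CR by (simp add: s_def field_simps)
            from CR(3)[OF this] obtain n where n: "n \<in> supp g" "s \<le> real n" "real n \<le> Cg * s" by blast
            have ns: "Cg * s = real (q - p) / 2" using CR by (simp add: s_def)
            have "n > 0" using n(2) \<open>s \<ge> R\<close> CR by (intro Nat.gr0I) auto
            define t where "t = p + n"
            have "n + p \<in> supp (g * (?F ^ h * g ^ j))"
              using n(1) j(2) unfolding mono_supp_def
              by (subst supp_mult_nonneg)
                 (auto intro!: Nats_nonneg fps_nth_mult_Nats fps_nth_power_Nats gamma_fps_Nats class_F_Nats[OF g])
            hence t: "t \<in> mono_supp \<rho> g (h, Suc j)" by (simp add: mono_supp_def t_def mult_ac add.commute)
            have "2 * Cg * R \<ge> 0" using CR by simp
            hence "real (q - p) > 2 * real k" using long k by linarith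
            hence "real n + real k < real (q - p)" using n(3) ns by linarith
            hence tk: "t + k < q" using pq by (simp add: t_def of_nat_diff)
            have pt: "p < t" using \<open>n > 0\<close> by (simp add: t_def)
            \<comment> \<open>Otherwise \<open>t\<close> would be a point of \<open>T\<close> inside
              the gap.\<close>
            have "Suc j = b"
            proof (rule ccontr)
              assume "Suc j \<noteq> b"
              hence "(h, Suc j) \<in> I" using j by (auto simp: I_def)
              hence "t \<in> T" unfolding T_def using t by blast
              thus False using gap pt tk by auto
            qed
            with t have "t \<in> mono_supp \<rho> g (h, b)" by simp
            from card_Z[OF pt tk this] have "real n \<le> real (card (Z \<inter> {p..<q}))" by (simp add: t_def)
            hence "s \<le> real (card (Z \<inter> {p..<q}))" using n by linarith
            hence "real (q - p) \<le> 2 * Cg * real (card (Z \<inter> {p..<q}))"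
              using CR by (simp add: s_def field_simps)
            moreover have "0 \<le> 2 * Cg * R + 2 * real N powr \<epsilon>" using CR by simp
            ultimately show ?thesis using False by simp
          qed (use False card_nonneg in auto)
        qed
      qed
    qed
  qed (use CR q0 \<epsilon> ex T0 in auto)
qed

text \<open>Discarding zero coefficients and clearing denominators leaves a relation whose
  coefficients are all nonzero elements of Z[\<beta>], which
  \<open>gamma_monomials_no_relation\<close> excludes. Its exponent conditions come from
  \<open>gap_exponents\<close>, as all powers of gamma are at most \<open>A\<close>.\<close>

theorem theorem3p7:
  fixes A :: nat and \<rho> \<beta> :: real and g :: "real fps"
  assumes "A > 0"
    and "A \<le> 3 \<Longrightarrow> \<rho> > real A"
    and "A \<ge> 4 \<Longrightarrow> \<rho> > inverse (sigma_zero A)"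
    and "g \<in> class_F"
    and "Pisot \<beta> \<or> Salem \<beta>"
  shows "lin_indep_family (rat_adjoin \<beta>) {(k1, k2). k1 \<le> A}
    (\<lambda>(k1 :: nat, k2 :: nat). gamma_val \<rho> (inverse \<beta>) ^ k1 * eval_fps g (inverse \<beta>) ^ k2)"
  unfolding lin_indep_family_def
proof (intro allI impI)
  fix J :: "(nat \<times> nat) set" and c :: "nat \<times> nat \<Rightarrow> real"
  let ?f = "\<lambda>(k1 :: nat, k2 :: nat). gamma_val \<rho> (inverse \<beta>) ^ k1 * eval_fps g (inverse \<beta>) ^ k2"
  assume J: "finite J" "J \<subseteq> {(k1, k2). k1 \<le> A}" and c: "\<forall>i\<in>J. c i \<in> rat_adjoin \<beta>"
    and rel: "(\<Sum>i\<in>J. c i * ?f i) = 0"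
  define J' where "J' = {i\<in>J. c i \<noteq> 0}"
  have J': "finite J'" "J' \<subseteq> J" using J by (auto simp: J'_def)
  obtain q :: "int poly" and C where qC: "poly (map_poly of_int q) \<beta> \<noteq> 0"
    "\<And>i. i \<in> J' \<Longrightarrow> c i * poly (map_poly of_int q) \<beta> = poly (map_poly of_int (C i)) \<beta>"
    using rat_adjoin_common_denominator[OF J'(1), of c \<beta>] c J'(2) by blast
  have C0: "poly (map_poly of_int (C k)) \<beta> \<noteq> 0" if "k \<in> J'" for k
    using qC(1) qC(2)[OF that] that by (auto simp: J'_def simp flip: qC(2))
  have "(\<Sum>k\<in>J'. poly (map_poly of_int (C k)) \<beta> * ?f k) = (\<Sum>k\<in>J'. c k * ?f k) * poly (map_poly of_int q) \<beta>"
    unfolding sum_distrib_right by (intro sum.cong) (simp_all add: mult_ac flip: qC(2))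
  also have "(\<Sum>k\<in>J'. c k * ?f k) = (\<Sum>k\<in>J. c k * ?f k)"
    using J by (intro sum.mono_neutral_left) (auto simp: J'_def)
  finally have rel': "(\<Sum>k\<in>J'. poly (map_poly of_int (C k)) \<beta> *
      (gamma_val \<rho> (inverse \<beta>) ^ fst k * eval_fps g (inverse \<beta>) ^ snd k)) = 0"
    using rel by (simp add: case_prod_unfold)
  have le: "i \<le> A" if "(i, j) \<in> J'" for i j using that J(2) J'(2) by auto
  have expo: "\<rho> > 1" "real h / \<rho> < 1" "(1 - 1 / \<rho>) ^ h + (real h - 1) * (1 / \<rho>) < 1" if "h \<le> A" for h
    using gap_exponents[of A \<rho> h] assms(1-3) that by blast+
  have "J' = {}"
  proof (rule ccontr)
    assume "J' \<noteq> {}"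
    from gamma_monomials_no_relation[OF J'(1) this C0 expo(1)[of 0] expo(2)[OF le] expo(3)[OF le] assms(4,5) rel']
    show False by simp
  qed
  thus "\<forall>i\<in>J. c i = 0" by (auto simp: J'_def)
qed

end
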